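(* Consider the high-dimensional setting described in the context, with $s_0=o(\sqrt n)$. Assume that there is a constant $C_0>0$ (not depending on $n$) such that the eigenvalues $0<\lambda_1(\Sigma)\le\cdots\le\lambda_p(\Sigma)$ of $\Sigma$ satisfy $C_0\le\lambda_1(\Sigma)\le\lambda_p(\Sigma)\le C_0^{-1}$. Then for each $i\in\{1,\dots,p\}$ (where $i=i_n$ may depend on $n$), $$\|\hat w_{i1}-w_{i1}\| = O_P\big(\sqrt{s_0/n}\big)\quad\text{as } n\to\infty .$$
   Context: Asymptotic setting: everything is indexed by the sample size $n\to\infty$; the dimension $p=p_n$ (which may grow with $n$), the sparsity $s_0=s_{0,n}\ge 1$, and the matrices below may depend on $n$. $X_1,\dots,X_n$ are i.i.d. random vectors from $N(\mu,\Sigma)$ in $\mathbb R^p$, with $\Sigma$ symmetric positive definite, and $\Omega=\Sigma^{-1}$ is the precision matrix, with columns $w_1,\dots,w_p$. The positions of the nonzero entries of $\Omega$ are known, and each column of $\Omega$ has exactly $s_0$ nonzero entries. For $i=1,\dots,p$, let $w_{i1}\in\mathbb R^{s_0}$ be the vector of the nonzero entries of $w_i$ (in their order of appearance), and let $B_i$ be the $p\times s_0$ zero-one matrix whose columns are the standard basis vectors of $\mathbb R^p$ indexed by the support of $w_i$, in increasing order, so that $B_iw_{i1}=w_i$. Let $e_i$ be the $i$-th standard basis vector of $\mathbb R^p$ and $\mathbf f_i=B_i^Te_i\in\mathbb R^{s_0}$. Let $\bar X=\frac1n\sum_{k=1}^nX_k$, let $S_n=\frac1{n-1}\sum_{k=1}^n(X_k-\bar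 X)(X_k-\bar X)^T$ be the sample covariance matrix, and $S_{ni}=B_i^TS_nB_i$ (almost surely invertible when $n>s_0$). The estimator of $w_{i1}$ is $\hat w_{i1}=(B_i^TS_nB_i)^{-1}B_i^Te_i=S_{ni}^{-1}\mathbf f_i$. $\|\cdot\|$ is the Euclidean norm. $X_n=O_P(Y_n)$ means that $X_n/Y_n$ is bounded in probability. *)

theory Defs
  imports "HOL-Probability.Probability" "Jordan_Normal_Form.Gauss_Jordan_Elimination"
    "Jordan_Normal_Form.Char_Poly"
begin

hide_const (open) Finite_Cartesian_Product.vec Finite_Cartesian_Product.mat
  Finite_Cartesian_Product.row Finite_Cartesian_Product.column Determinants.det
no_notation Finite_Cartesian_Product.vec_nth (infixl "$" 90)
no_notation Inner_Product.real_inner_class.inner (infix "\<bullet>" 70)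

text \<open>Matrices and vectors are those of \<^theory>\<open>Jordan_Normal_Form.Matrix\<close>, since the dimension
  varies with the sample size; all indices start at 0.\<close>

definition pos_def_mat :: "real mat \<Rightarrow> bool" where
  "pos_def_mat A \<longleftrightarrow> square_mat A \<and> transpose_mat A = A \<and>
     (\<forall>v \<in> carrier_vec (dim_row A). v \<noteq> 0\<^sub>v (dim_row A) \<longrightarrow> v \<bullet> (A *\<^sub>v v) > 0)"

definition eucl_norm :: "real vec \<Rightarrow> real" where
  "eucl_norm v = sqrt (v \<bullet> v)"

text \<open>The inverse matrix. A singular matrix gets the zero matrix, so that the estimator below
  is total; for sample covariance matrices this concerns only a null event or small samples.\<close>

definition inv_mat :: "real mat \<Rightarrow> real mat" where
  "inv_mat A = (case mat_inverse A of Some B \<Rightarrow> B | None \<Rightarrow> 0\<^sub>m (dim_row A) (dim_row A))"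

text \<open>Random vectors in $p$-dimensional space take values in the product space
  \<^term>\<open>Pi\<^sub>M {..<p} (\<lambda>_. borel)\<close> (coordinates \<open>x 0, ..., x (p - 1)\<close>). For positive definite
  \<open>\<Sigma>\<close>, the law $N(\mu,\Sigma)$ is given by its Lebesgue density.\<close>

definition mvn_density :: "real vec \<Rightarrow> real mat \<Rightarrow> (nat \<Rightarrow> real) \<Rightarrow> real" where
  "mvn_density \<mu> \<Sigma> x =
     (let p = dim_vec \<mu>; d = vec p x - \<mu>
      in exp (- (d \<bullet> (inv_mat \<Sigma> *\<^sub>v d)) / 2) / sqrt ((2 * pi) ^ p * det \<Sigma>))"

definition mvn_distributed ::
  "'a measure \<Rightarrow> ('a \<Rightarrow> nat \<Rightarrow> real) \<Rightarrow> real vec \<Rightarrow> real mat \<Rightarrow> bool" where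
  "mvn_distributed M X \<mu> \<Sigma> \<longleftrightarrow>
     distributed M (Pi\<^sub>M {..<dim_vec \<mu>} (\<lambda>_. lborel)) X (\<lambda>x. ennreal (mvn_density \<mu> \<Sigma> x))"

definition sample_mean :: "nat \<Rightarrow> (nat \<Rightarrow> nat \<Rightarrow> real) \<Rightarrow> nat \<Rightarrow> real" where
  "sample_mean n x a = (\<Sum>k<n. x k a) / real n"

definition sample_cov :: "nat \<Rightarrow> nat \<Rightarrow> (nat \<Rightarrow> nat \<Rightarrow> real) \<Rightarrow> real mat" where
  "sample_cov p n x = mat p p (\<lambda>(a, b).
     (\<Sum>k<n. (x k a - sample_mean n x a) * (x k b - sample_mean n x b)) / (real n - 1))"

definition col_support :: "real mat \<Rightarrow> nat \<Rightarrow> nat set" where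
  "col_support A j = {r. r < dim_row A \<and> A $$ (r, j) \<noteq> 0}"

definition nonzero_entries :: "real vec \<Rightarrow> real vec" where
  "nonzero_entries v = vec_of_list (filter (\<lambda>x. x \<noteq> 0) (list_of_vec v))"

text \<open>The zero-one matrix $B_i$ for the support of column \<open>i\<close> of \<open>A\<close>.\<close>

definition selection_mat :: "real mat \<Rightarrow> nat \<Rightarrow> real mat" where
  "selection_mat A i = mat_of_cols (dim_row A)
     (map (unit_vec (dim_row A)) (sorted_list_of_set (col_support A i)))"

lemma selection_mat_nonzero_entries:
  assumes "i < dim_col A"
  shows "selection_mat A i *\<^sub>v nonzero_entries (col A i) = col A i"
proof -
  let ?n = "dim_row A"
  let ?S = "sorted_list_of_set (col_support A i)"
  have fin: "finite (col_support A i)" by (simp add: col_support_def)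
  have S: "?S = filter (\<lambda>r. A $$ (r, i) \<noteq> 0) [0..<?n]"
    by (rule sorted_distinct_set_unique)
       (auto simp: fin col_support_def intro: sorted_wrt_filter)
  have "list_of_vec (col A i) = map (\<lambda>r. A $$ (r, i)) [0..<?n]"
    using assms by (intro nth_equalityI) (auto simp: list_of_vec_index)
  then have w: "nonzero_entries (col A i) = vec_of_list (map (\<lambda>r. A $$ (r, i)) ?S)"
    by (simp add: nonzero_entries_def S filter_map o_def)
  have set: "set ?S = col_support A i" "distinct ?S" using fin by auto
  show ?thesis
  proof (rule eq_vecI)
    fix r assume "r < dim_vec (col A i)"
    then have r: "r < ?n" by simp
    have lt: "?S ! k < ?n" if "k < length ?S" for k
      using nth_mem[OF that] unfolding set col_support_def by auto
    have "(selection_mat A i *\<^sub>v nonzero_entries (col A i)) $ r =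
        (\<Sum>k<length ?S. unit_vec ?n (?S ! k) $ r * A $$ (?S ! k, i))"
      using r by (simp add: w selection_mat_def scalar_prod_def mat_of_cols_index
          vec_of_list_index lessThan_atLeast0)
    also have "\<dots> = (\<Sum>k<length ?S. if ?S ! k = r then A $$ (r, i) else 0)"
      using r lt by (intro sum.cong) (auto simp: unit_vec_def)
    also have "\<dots> = (\<Sum>s\<in>set ?S. if s = r then A $$ (r, i) else 0)"
      using set(2) by (intro sum.reindex_bij_betw bij_betw_nth) auto
    also have "\<dots> = A $$ (r, i)"
      using r unfolding set by (simp add: fin) (simp add: col_support_def)
    finally show "(selection_mat A i *\<^sub>v nonzero_entries (col A i)) $ r = col A i $ r"
      using r assms by simp
  qed (simp add: selection_mat_def)
qed

text \<open>The estimator uses the precision matrix \<open>\<Omega>\<close> only through the positions of its nonzero entries.\<close>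

definition precision_col_estimator :: "real mat \<Rightarrow> nat \<Rightarrow> real mat \<Rightarrow> real vec" where
  "precision_col_estimator \<Omega> i S =
     (let B = selection_mat \<Omega> i
      in inv_mat (transpose_mat B * S * B) *\<^sub>v (transpose_mat B *\<^sub>v unit_vec (dim_row \<Omega>) i))"

text \<open>$Z_n = O_P(Y_n)$, where the \<open>n\<close>-th variables live on their own probability space. Since
  \<^const>\<open>measure\<close> is 0 on non-measurable sets, measurability of the event is required explicitly.\<close>

definition bounded_in_prob :: "(nat \<Rightarrow> 'a measure) \<Rightarrow> (nat \<Rightarrow> 'a \<Rightarrow> real) \<Rightarrow> bool" where
  "bounded_in_prob M Z \<longleftrightarrow> (\<forall>\<epsilon>>0. \<exists>K. \<forall>\<^sub>F n in sequentially.
     {\<omega> \<in> space (M n). \<bar>Z n \<omega>\<bar> > K} \<in> sets (M n) \<and>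
     measure (M n) {\<omega> \<in> space (M n). \<bar>Z n \<omega>\<bar> > K} \<le> \<epsilon>)"

definition bigOP :: "(nat \<Rightarrow> 'a measure) \<Rightarrow> (nat \<Rightarrow> 'a \<Rightarrow> real) \<Rightarrow> (nat \<Rightarrow> 'a \<Rightarrow> real) \<Rightarrow> bool" where
  "bigOP M Z Y \<longleftrightarrow> bounded_in_prob M (\<lambda>n \<omega>. Z n \<omega> / Y n \<omega>)"

end

theory Submission
  imports Defs "HOL-Real_Asymp.Real_Asymp"
begin

text \<open>Write \<open>w\<close> for the vector of nonzero entries of column \<open>i\<close> of \<open>\<Omega>\<close>, \<open>B\<close> for the selection
matrix, \<open>A = B\<^sup>T \<Sigma> B\<close> and \<open>S = B\<^sup>T S\<^sub>n B\<close>. Since \<open>B w\<close> is column \<open>i\<close> of \<open>\<Sigma>\<^sup>-\<^sup>1\<close>, one has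
\<open>A w = B\<^sup>T e\<^sub>i\<close>, so the estimator is \<open>S\<^sup>-\<^sup>1 A w\<close> and its error is \<open>S\<^sup>-\<^sup>1 (A - S) w\<close>.

The quadratic form of \<open>A\<close> is bounded below by \<open>C\<^sub>0\<close>. If \<open>S\<close> is within \<open>C\<^sub>0 / 2\<close> of \<open>A\<close> in Frobenius
norm, then the quadratic form of \<open>S\<close> is bounded below by \<open>C\<^sub>0 / 2\<close>, so the error has norm at most
\<open>2 / C\<^sub>0\<close> times the norm of \<open>(S - A) w\<close> (\<open>inv_mat_perturbation\<close>). It remains to control the
two random quantities in this statement. Their squares are sums of \<open>s\<^sub>0\<^sup>2\<close>, respectively \<open>s\<^sub>0\<close>,
terms of the form \<open>(u\<^sup>T (S\<^sub>n - \<Sigma>) v)\<^sup>2\<close> with \<open>u\<close> and \<open>v\<close> of bounded norm, and each of these has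
expectation of order \<open>1 / n\<close> (\<open>sample_cov_bilinear_form_deviation\<close>). Markov's inequality therefore
makes the Frobenius condition fail with probability of order \<open>s\<^sub>0\<^sup>2 / n\<close>, which tends to 0, and gives
norm \<open>O\<^sub>P(sqrt (s\<^sub>0 / n))\<close> for \<open>(S - A) w\<close>.

By polarization the moment bound needs only \<open>u = v\<close>, where \<open>u\<^sup>T S\<^sub>n u\<close> is the sample variance of the
real variables \<open>u\<^sup>T (X\<^sub>k - \<mu>)\<close>. Besides their independence, the argument uses that these variables
have moment generating function \<open>exp (t\<^sup>2 v / 2)\<close> with \<open>v = u\<^sup>T \<Sigma> u\<close>. This follows from the density by
completing the square, because Lebesgue measure is invariant under translations and the density
integrates to 1. The moment generating function determines the second moment, bounds the fourth,
and passes to means of independent copies.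

The eigenvalue hypothesis enters through the two bounds \<open>C\<^sub>0 |v|\<^sup>2 \<le> v\<^sup>T \<Sigma> v \<le> |v|\<^sup>2 / C\<^sub>0\<close>, which follow
from the fact that the infimum of the Rayleigh quotient of a symmetric matrix is an eigenvalue.\<close>

section \<open>Inverses and quadratic forms of real matrices\<close>

lemma scalar_prod_self_nonneg: "v \<bullet> v \<ge> (0 :: real)"
  by (auto simp: scalar_prod_def intro: sum_nonneg)

lemma eucl_norm_square: "(eucl_norm v)\<^sup>2 = v \<bullet> v"
  by (simp add: eucl_norm_def scalar_prod_self_nonneg)

lemma eucl_norm_nonneg: "eucl_norm v \<ge> 0"
  by (simp add: eucl_norm_def scalar_prod_self_nonneg)

text \<open>The library inequalities for \<open>L2_set\<close> transfer to \<open>eucl_norm\<close> through this identity.\<close>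

lemma eucl_norm_L2: "eucl_norm v = L2_set (\<lambda>a. v $ a) {0..<dim_vec v}"
  by (simp add: eucl_norm_def L2_set_def scalar_prod_def power2_eq_square)

lemma eucl_norm_triangle:
  assumes "u \<in> carrier_vec n" "v \<in> carrier_vec n"
  shows "eucl_norm (u + v) \<le> eucl_norm u + eucl_norm v"
proof -
  have "eucl_norm (u + v) = L2_set (\<lambda>a. u $ a + v $ a) {0..<n}"
    unfolding eucl_norm_L2 using assms by (intro L2_set_cong) auto
  also have "\<dots> \<le> L2_set (\<lambda>a. u $ a) {0..<n} + L2_set (\<lambda>a. v $ a) {0..<n}" by (rule L2_set_triangle_ineq)
  finally show ?thesis using assms by (simp add: eucl_norm_L2)
qed

lemma scalar_prod_le_eucl_norm:
  assumes "u \<in> carrier_vec n" "v \<in> carrier_vec n"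
  shows "u \<bullet> v \<le> eucl_norm u * eucl_norm v"
proof -
  have "u \<bullet> v \<le> (\<Sum>a\<in>{0..<n}. \<bar>u $ a\<bar> * \<bar>v $ a\<bar>)"
    using assms by (auto simp: scalar_prod_def abs_mult[symmetric] intro!: sum_mono)
  also have "\<dots> \<le> L2_set (\<lambda>a. u $ a) {0..<n} * L2_set (\<lambda>a. v $ a) {0..<n}" by (rule L2_set_mult_ineq)
  finally show ?thesis using assms by (simp add: eucl_norm_L2)
qed

lemma eucl_norm_eq_0:
  assumes "v \<in> carrier_vec n" "eucl_norm v = 0"
  shows "v = 0\<^sub>v n"
  using assms by (intro eq_vecI) (auto simp: eucl_norm_L2 L2_set_eq_0_iff)

lemma eucl_norm_smult: "eucl_norm (c \<cdot>\<^sub>v v) = \<bar>c\<bar> * eucl_norm v"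
  by (simp add: eucl_norm_def real_sqrt_mult[symmetric] mult.assoc[symmetric])
     (simp add: real_sqrt_mult)

definition frobenius_norm_sq :: "real mat \<Rightarrow> real" where
  "frobenius_norm_sq A = (\<Sum>a<dim_row A. \<Sum>b<dim_col A. (A $$ (a, b))\<^sup>2)"

lemma eucl_norm_mult_mat_vec_le:
  assumes A: "A \<in> carrier_mat m n" and v: "v \<in> carrier_vec n"
  shows "eucl_norm (A *\<^sub>v v) \<le> sqrt (frobenius_norm_sq A) * eucl_norm v"
proof -
  have "(A *\<^sub>v v) \<bullet> (A *\<^sub>v v) = (\<Sum>a<m. (row A a \<bullet> v)\<^sup>2)"
    using A by (simp add: scalar_prod_def[of "A *\<^sub>v v"] lessThan_atLeast0 power2_eq_square)
  also have "\<dots> \<le> (\<Sum>a<m. (row A a \<bullet> row A a) * (v \<bullet> v))"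
  proof (intro sum_mono)
    fix a assume "a \<in> {..<m}"
    show "(row A a \<bullet> v)\<^sup>2 \<le> (row A a \<bullet> row A a) * (v \<bullet> v)"
      using A v Cauchy_Schwarz_ineq_sum[of "\<lambda>b. row A a $ b" "\<lambda>b. v $ b" "{0..<n}"]
      by (simp add: scalar_prod_def power2_eq_square)
  qed
  also have "\<dots> = frobenius_norm_sq A * (v \<bullet> v)"
    using A by (simp add: frobenius_norm_sq_def sum_distrib_right[symmetric] scalar_prod_def lessThan_atLeast0 power2_eq_square)
  finally have "sqrt ((A *\<^sub>v v) \<bullet> (A *\<^sub>v v)) \<le> sqrt (frobenius_norm_sq A * (v \<bullet> v))" by simp
  then show ?thesis by (simp add: eucl_norm_def real_sqrt_mult)
qed

lemma abs_quadratic_form_le: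
  assumes A: "A \<in> carrier_mat n n" and v: "v \<in> carrier_vec n"
  shows "\<bar>v \<bullet> (A *\<^sub>v v)\<bar> \<le> sqrt (frobenius_norm_sq A) * (v \<bullet> v)"
proof -
  have le: "w \<bullet> (A *\<^sub>v v) \<le> sqrt (frobenius_norm_sq A) * (v \<bullet> v)" if w: "w \<in> carrier_vec n" "eucl_norm w = eucl_norm v" for w
  proof -
    have "w \<bullet> (A *\<^sub>v v) \<le> eucl_norm w * eucl_norm (A *\<^sub>v v)"
      using A v w by (intro scalar_prod_le_eucl_norm) auto
    also have "\<dots> \<le> eucl_norm v * (sqrt (frobenius_norm_sq A) * eucl_norm v)"
      unfolding w(2) by (intro mult_left_mono eucl_norm_mult_mat_vec_le[OF A v] eucl_norm_nonneg)
    also have "\<dots> = sqrt (frobenius_norm_sq A) * (v \<bullet> v)"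
      by (simp add: eucl_norm_square[symmetric] power2_eq_square)
    finally show ?thesis .
  qed
  have "- (v \<bullet> (A *\<^sub>v v)) = (- v) \<bullet> (A *\<^sub>v v)" using A v by simp
  moreover have "eucl_norm (- v) = eucl_norm v" using v by (simp add: eucl_norm_def)
  ultimately show ?thesis using le[of v] le[of "- v"] v by (simp add: abs_le_iff)
qed

lemma scalar_prod_symmetric_mat:
  fixes A :: "real mat"
  assumes "A \<in> carrier_mat n n" "transpose_mat A = A" "u \<in> carrier_vec n" "v \<in> carrier_vec n"
  shows "u \<bullet> (A *\<^sub>v v) = v \<bullet> (A *\<^sub>v u)"
proof -
  have "v \<bullet> (A *\<^sub>v u) = (transpose_mat A *\<^sub>v v) \<bullet> u"
    using transpose_vec_mult_scalar[of A n n u v] assms by simp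
  also have "\<dots> = u \<bullet> (A *\<^sub>v v)"
    using assms comm_scalar_prod[of "A *\<^sub>v v" n u] by simp
  finally show ?thesis ..
qed

lemma quadratic_form_add:
  fixes A :: "real mat"
  assumes "A \<in> carrier_mat n n" "transpose_mat A = A" "u \<in> carrier_vec n" "v \<in> carrier_vec n"
  shows "(u + v) \<bullet> (A *\<^sub>v (u + v)) = u \<bullet> (A *\<^sub>v u) + 2 * (u \<bullet> (A *\<^sub>v v)) + v \<bullet> (A *\<^sub>v v)"
  using assms scalar_prod_symmetric_mat[OF assms]
  by (simp add: mult_add_distrib_mat_vec[of A n n] add_scalar_prod_distrib[of _ n] scalar_prod_add_distrib[of _ n])

lemma inv_mat_works:
  assumes A: "A \<in> carrier_mat n n" and inj: "\<And>v. v \<in> carrier_vec n \<Longrightarrow> A *\<^sub>v v = 0\<^sub>v n \<Longrightarrow> v = 0\<^sub>v n"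
  shows "inv_mat A \<in> carrier_mat n n" "A * inv_mat A = 1\<^sub>m n" "inv_mat A * A = 1\<^sub>m n"
proof -
  have "det A \<noteq> 0" using det_0_iff_vec_prod_zero[OF A] inj by auto
  then have "A \<in> Units (ring_mat TYPE(real) n ())" by (rule det_non_zero_imp_unit[OF A])
  then obtain B where B: "mat_inverse A = Some B" using mat_inverse(1)[OF A, of "()"] by (cases "mat_inverse A") auto
  then show "inv_mat A \<in> carrier_mat n n" "A * inv_mat A = 1\<^sub>m n" "inv_mat A * A = 1\<^sub>m n"
    using mat_inverse(2)[OF A B] by (auto simp: inv_mat_def)
qed

lemma pos_def_mat_inverse:
  assumes A: "A \<in> carrier_mat n n" and pd: "pos_def_mat A"
  shows "inv_mat A \<in> carrier_mat n n" "A * inv_mat A = 1\<^sub>m n" "inv_mat A * A = 1\<^sub>m n"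
    "transpose_mat (inv_mat A) = inv_mat A"
proof -
  have inj: "v = 0\<^sub>v n" if "v \<in> carrier_vec n" "A *\<^sub>v v = 0\<^sub>v n" for v
    using pd that A unfolding pos_def_mat_def by fastforce
  note I = inv_mat_works[OF A inj]
  show "inv_mat A \<in> carrier_mat n n" "A * inv_mat A = 1\<^sub>m n" "inv_mat A * A = 1\<^sub>m n" using I by blast+
  have sA: "transpose_mat A = A" using pd by (simp add: pos_def_mat_def)
  have t: "transpose_mat (inv_mat A) * A = 1\<^sub>m n"
    using transpose_mult[OF A I(1)] sA I(2) by simp
  have "transpose_mat (inv_mat A) = transpose_mat (inv_mat A) * (A * inv_mat A)" using I by simp
  also have "\<dots> = (transpose_mat (inv_mat A) * A) * inv_mat A"
    using I(1) A by (intro assoc_mult_mat[symmetric]) auto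
  also have "\<dots> = inv_mat A" using t I by simp
  finally show "transpose_mat (inv_mat A) = inv_mat A" .
qed

text \<open>The loss of at most half of the coercivity constant \<open>c\<close> in passing from \<open>A\<close> to \<open>S\<close> makes \<open>S\<close>
invertible. The error \<open>d\<close> solves \<open>S d = - (S - A) w\<close>, and testing this equation against \<open>d\<close> gives the
bound.\<close>

lemma inv_mat_perturbation:
  fixes A S :: "real mat"
  assumes A: "A \<in> carrier_mat n n" and S: "S \<in> carrier_mat n n" and c: "c > 0"
    and low: "\<And>v. v \<in> carrier_vec n \<Longrightarrow> c * (v \<bullet> v) \<le> v \<bullet> (A *\<^sub>v v)"
    and frob: "frobenius_norm_sq (S - A) \<le> (c / 2)\<^sup>2" and w: "w \<in> carrier_vec n"
  shows "eucl_norm (inv_mat S *\<^sub>v (A *\<^sub>v w) - w) \<le> 2 / c * eucl_norm ((S - A) *\<^sub>v w)"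
proof -
  have lowS: "c / 2 * (v \<bullet> v) \<le> v \<bullet> (S *\<^sub>v v)" if v: "v \<in> carrier_vec n" for v
  proof -
    have D: "S - A \<in> carrier_mat n n" by (rule minus_carrier_mat[OF A])
    have "sqrt (frobenius_norm_sq (S - A)) \<le> c / 2" using real_sqrt_le_mono[OF frob] c by simp
    then have "sqrt (frobenius_norm_sq (S - A)) * (v \<bullet> v) \<le> c / 2 * (v \<bullet> v)"
      by (intro mult_right_mono scalar_prod_self_nonneg)
    with abs_quadratic_form_le[OF D v] have "- (c / 2 * (v \<bullet> v)) \<le> v \<bullet> ((S - A) *\<^sub>v v)" by linarith
    also have "v \<bullet> ((S - A) *\<^sub>v v) = v \<bullet> (S *\<^sub>v v) - v \<bullet> (A *\<^sub>v v)"
      using A S v by (simp add: minus_mult_distrib_mat_vec[of _ n n] scalar_prod_minus_distrib[of _ n])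
    finally show ?thesis using low[OF v] by simp
  qed
  have inj: "v = 0\<^sub>v n" if v: "v \<in> carrier_vec n" and 0: "S *\<^sub>v v = 0\<^sub>v n" for v
  proof -
    have "c / 2 * (v \<bullet> v) \<le> 0" using lowS[OF v] v unfolding 0 by simp
    then have "v \<bullet> v \<le> 0" using c by (simp add: mult_le_0_iff)
    then have "eucl_norm v = 0" using scalar_prod_self_nonneg[of v] by (simp add: eucl_norm_def)
    with v show ?thesis by (rule eucl_norm_eq_0)
  qed
  note I = inv_mat_works[OF S inj]
  define d where "d = inv_mat S *\<^sub>v (A *\<^sub>v w) - w"
  have Aw: "A *\<^sub>v w \<in> carrier_vec n" using A w by simp
  have d: "d \<in> carrier_vec n" using I(1) A w by (simp add: d_def)
  have "S *\<^sub>v (inv_mat S *\<^sub>v (A *\<^sub>v w)) = A *\<^sub>v w"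
    using I S Aw by (simp add: assoc_mult_mat_vec[of S n n "inv_mat S" n, symmetric])
  then have "S *\<^sub>v d = A *\<^sub>v w - S *\<^sub>v w"
    unfolding d_def using I(1) S Aw w by (simp add: mult_minus_distrib_mat_vec[of S n n])
  also have "\<dots> = - ((S - A) *\<^sub>v w)"
    using A S w by (simp add: minus_mult_distrib_mat_vec[of _ n n]) (intro eq_vecI; simp)
  finally have Sd: "S *\<^sub>v d = - ((S - A) *\<^sub>v w)" .
  have "c / 2 * (eucl_norm d)\<^sup>2 \<le> d \<bullet> (S *\<^sub>v d)" using lowS[OF d] by (simp add: eucl_norm_square)
  also have "\<dots> \<le> eucl_norm d * eucl_norm (S *\<^sub>v d)"
    using S d by (intro scalar_prod_le_eucl_norm) auto
  also have "eucl_norm (S *\<^sub>v d) = eucl_norm ((S - A) *\<^sub>v w)"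
    unfolding Sd by (simp add: eucl_norm_def)
  finally have "c / 2 * eucl_norm d * eucl_norm d \<le> eucl_norm ((S - A) *\<^sub>v w) * eucl_norm d"
    by (simp add: power2_eq_square mult_ac)
  then have "c / 2 * eucl_norm d \<le> eucl_norm ((S - A) *\<^sub>v w)"
    using eucl_norm_nonneg[of d] eucl_norm_nonneg[of "(S - A) *\<^sub>v w"]
    by (cases "eucl_norm d = 0") (auto simp: mult_le_cancel_right)
  then show ?thesis using c by (simp add: d_def field_simps)
qed

section \<open>The eigenvalue bounds control the quadratic form\<close>

text \<open>The usual discriminant argument. When \<open>v\<close> has form value 0, the quadratic in \<open>t\<close> degenerates to the
affine function \<open>a + 2 t b\<close>, which is nonnegative only if \<open>b = 0\<close>.\<close>

lemma psd_Cauchy_Schwarz: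
  fixes P :: "real mat"
  assumes P: "P \<in> carrier_mat n n" "transpose_mat P = P"
    and psd: "\<And>v. v \<in> carrier_vec n \<Longrightarrow> 0 \<le> v \<bullet> (P *\<^sub>v v)"
    and u: "u \<in> carrier_vec n" and v: "v \<in> carrier_vec n"
  shows "(u \<bullet> (P *\<^sub>v v))\<^sup>2 \<le> (u \<bullet> (P *\<^sub>v u)) * (v \<bullet> (P *\<^sub>v v))"
proof -
  define a b c where "a = u \<bullet> (P *\<^sub>v u)" and "b = u \<bullet> (P *\<^sub>v v)" and "c = v \<bullet> (P *\<^sub>v v)"
  have q: "0 \<le> a + 2 * t * b + t\<^sup>2 * c" for t
  proof -
    have "0 \<le> (u + t \<cdot>\<^sub>v v) \<bullet> (P *\<^sub>v (u + t \<cdot>\<^sub>v v))" using u v by (intro psd) auto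
    also have "\<dots> = a + 2 * t * b + t\<^sup>2 * c"
      using quadratic_form_add[OF P u, of "t \<cdot>\<^sub>v v"] u v P
      by (simp add: mult_mat_vec[OF P(1) v] a_def b_def c_def power2_eq_square)
    finally show ?thesis .
  qed
  have c0: "c \<ge> 0" unfolding c_def by (rule psd[OF v])
  show ?thesis
  proof (cases "c = 0")
    case True
    have "b = 0"
    proof (rule ccontr)
      assume "b \<noteq> 0"
      with q[of "- (a + 1) / (2 * b)"] True show False by (simp add: field_simps)
    qed
    then show ?thesis using True by (simp add: a_def[symmetric] b_def[symmetric] c_def[symmetric])
  next
    case False
    with q[of "- b / c"] c0 show ?thesis
      by (simp add: a_def[symmetric] b_def[symmetric] c_def[symmetric] field_simps power2_eq_square)
  qed
qed

text \<open>Let \<open>m\<close> be the infimum of the Rayleigh quotient. Then \<open>P = A - m I\<close> is positive semidefinite, and the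
claim is that \<open>P\<close> is singular. If \<open>P\<close> were invertible, the Cauchy-Schwarz
inequality for \<open>P\<close> applied to a unit vector \<open>v\<close> and \<open>P\<^sup>-\<^sup>1 v\<close> would bound \<open>v\<^sup>T P v\<close> below by a positive
constant, so that \<open>m\<close> could be increased.\<close>

lemma rayleigh_infimum_eigenvalue:
  fixes A :: "real mat"
  assumes A: "A \<in> carrier_mat n n" "transpose_mat A = A" and n: "n > 0"
  shows "\<exists>m. eigenvalue A m \<and> (\<forall>v \<in> carrier_vec n. m * (v \<bullet> v) \<le> v \<bullet> (A *\<^sub>v v))"
proof -
  define R where "R = {v \<bullet> (A *\<^sub>v v) | v. v \<in> carrier_vec n \<and> v \<bullet> v = 1}"
  define m where "m = Inf R"
  have unit: "unit_vec n 0 \<bullet> (A *\<^sub>v unit_vec n 0) \<in> R"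
    using n unfolding R_def by (auto intro!: exI[of _ "unit_vec n 0"])
  then have ne: "R \<noteq> {}" by blast
  have bdd: "bdd_below R"
  proof (rule bdd_belowI)
    fix r assume "r \<in> R"
    then obtain v where v: "v \<in> carrier_vec n" "v \<bullet> v = 1" "r = v \<bullet> (A *\<^sub>v v)" by (auto simp: R_def)
    show "- sqrt (frobenius_norm_sq A) \<le> r" using abs_quadratic_form_le[OF A(1) v(1)] v by simp
  qed
  have low: "m * (v \<bullet> v) \<le> v \<bullet> (A *\<^sub>v v)" if v: "v \<in> carrier_vec n" for v
  proof (cases "v = 0\<^sub>v n")
    case True
    then show ?thesis using A by simp
  next
    case False
    define c where "c = eucl_norm v"
    have c: "c > 0" using eucl_norm_eq_0[OF v] False eucl_norm_nonneg[of v] by (auto simp: c_def order_less_le)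
    have c2: "v \<bullet> v = c\<^sup>2" by (simp add: c_def eucl_norm_square)
    let ?u = "(1 / c) \<cdot>\<^sub>v v"
    have "?u \<bullet> ?u = 1" using v c c2 by (simp add: power2_eq_square)
    moreover have "?u \<bullet> (A *\<^sub>v ?u) = v \<bullet> (A *\<^sub>v v) / c\<^sup>2"
      using v A by (simp add: mult_mat_vec[OF A(1) v] power2_eq_square)
    ultimately have "v \<bullet> (A *\<^sub>v v) / c\<^sup>2 \<in> R" unfolding R_def using v
      by (intro CollectI exI[of _ ?u]) auto
    then have "m \<le> v \<bullet> (A *\<^sub>v v) / c\<^sup>2" unfolding m_def by (rule cInf_lower[OF _ bdd])
    then show ?thesis using c c2 by (simp add: field_simps)
  qed
  define P where "P = A + ((- m) \<cdot>\<^sub>m 1\<^sub>m n)"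
  have P: "P \<in> carrier_mat n n" "char_matrix A m = P" using A by (auto simp: P_def char_matrix_def)
  have sP: "transpose_mat P = P"
    using A by (intro eq_matI) (auto simp: P_def, metis carrier_matD index_transpose_mat(1))
  have Pv: "P *\<^sub>v v = A *\<^sub>v v - m \<cdot>\<^sub>v v" if "v \<in> carrier_vec n" for v
  proof -
    have "((- m) \<cdot>\<^sub>m 1\<^sub>m n) *\<^sub>v v = - (m \<cdot>\<^sub>v v)"
      using that by (intro eq_vecI) (auto simp: row_smult)
    then show ?thesis
      unfolding P_def using A that by (simp add: add_mult_distrib_mat_vec[of _ n n]) (intro eq_vecI; simp)
  qed
  have qP: "v \<bullet> (P *\<^sub>v v) = v \<bullet> (A *\<^sub>v v) - m * (v \<bullet> v)" if "v \<in> carrier_vec n" for v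
    unfolding Pv[OF that] using that A by (simp add: scalar_prod_minus_distrib[of _ n])
  have psd: "0 \<le> v \<bullet> (P *\<^sub>v v)" if "v \<in> carrier_vec n" for v
    using low[OF that] qP[OF that] by simp
  have "det P = 0"
  proof (rule ccontr)
    assume "det P \<noteq> 0"
    then have "\<And>v. v \<in> carrier_vec n \<Longrightarrow> P *\<^sub>v v = 0\<^sub>v n \<Longrightarrow> v = 0\<^sub>v n"
      using det_0_iff_vec_prod_zero[OF P(1)] by auto
    note I = inv_mat_works[OF P(1) this]
    (* The summand 1 makes F positive. *)
  define F where "F = sqrt (frobenius_norm_sq (inv_mat P)) + 1"
    have F: "F > 0" unfolding F_def frobenius_norm_sq_def by (intro add_nonneg_pos real_sqrt_ge_zero sum_nonneg) auto
    have lowP: "1 / F \<le> v \<bullet> (P *\<^sub>v v)" if v: "v \<in> carrier_vec n" "v \<bullet> v = 1" for v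
    proof -
      let ?w = "inv_mat P *\<^sub>v v"
      have w: "?w \<in> carrier_vec n" and Pw: "P *\<^sub>v ?w = v"
        using I P v by (auto simp: assoc_mult_mat_vec[symmetric])
      have "1 = (v \<bullet> (P *\<^sub>v ?w))\<^sup>2" using v Pw by simp
      also have "\<dots> \<le> (v \<bullet> (P *\<^sub>v v)) * (?w \<bullet> (P *\<^sub>v ?w))"
        by (rule psd_Cauchy_Schwarz[OF P(1) sP psd v(1) w])
      also have "?w \<bullet> (P *\<^sub>v ?w) = v \<bullet> ?w" unfolding Pw using v w comm_scalar_prod by blast
      also have "(v \<bullet> (P *\<^sub>v v)) * (v \<bullet> ?w) \<le> (v \<bullet> (P *\<^sub>v v)) * F"
        using abs_quadratic_form_le[OF I(1) v(1)] v psd[OF v(1)] by (intro mult_left_mono) (auto simp: F_def)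
      finally show ?thesis using F by (simp add: field_simps)
    qed
    have "m + 1 / F \<le> Inf R"
    proof (rule cInf_greatest[OF ne])
      fix r assume "r \<in> R"
      then obtain v where v: "v \<in> carrier_vec n" "v \<bullet> v = 1" "r = v \<bullet> (A *\<^sub>v v)" by (auto simp: R_def)
      show "m + 1 / F \<le> r" using lowP[OF v(1,2)] qP[OF v(1)] v by simp
    qed
    then show False using F unfolding m_def by simp
  qed
  then have "eigenvalue A m" using eigenvalue_det[OF A(1)] P by simp
  then show ?thesis using low by blast
qed

lemma eigenvalue_lower_bound_quadratic_form:
  fixes A :: "real mat"
  assumes A: "A \<in> carrier_mat n n" "transpose_mat A = A"
    and ev: "\<And>l. eigenvalue A l \<Longrightarrow> c \<le> l" and v: "v \<in> carrier_vec n"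
  shows "c * (v \<bullet> v) \<le> v \<bullet> (A *\<^sub>v v)"
proof (cases "n = 0")
  case False
  then obtain m where m: "eigenvalue A m" "m * (v \<bullet> v) \<le> v \<bullet> (A *\<^sub>v v)"
    using rayleigh_infimum_eigenvalue[OF A] v by auto
  have "c * (v \<bullet> v) \<le> m * (v \<bullet> v)" using ev[OF m(1)] by (intro mult_right_mono scalar_prod_self_nonneg)
  with m(2) show ?thesis by simp
qed (use v A in \<open>auto simp: scalar_prod_def\<close>)

lemma eigenvalue_upper_bound_quadratic_form:
  fixes A :: "real mat"
  assumes A: "A \<in> carrier_mat n n" "transpose_mat A = A"
    and ev: "\<And>l. eigenvalue A l \<Longrightarrow> l \<le> c" and v: "v \<in> carrier_vec n"
  shows "v \<bullet> (A *\<^sub>v v) \<le> c * (v \<bullet> v)"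
proof -
  have neg: "(- A) *\<^sub>v w = - (A *\<^sub>v w)" if "w \<in> carrier_vec n" for w
    using A that by (intro eq_vecI) (auto simp: scalar_prod_def sum_negf)
  have "- c * (v \<bullet> v) \<le> v \<bullet> ((- A) *\<^sub>v v)"
  proof (rule eigenvalue_lower_bound_quadratic_form[OF _ _ _ v])
    show "- A \<in> carrier_mat n n" using A by simp
    show "transpose_mat (- A) = - A"
      using A by (metis transpose_uminus)
    fix l assume "eigenvalue (- A) l"
    then obtain w where w: "w \<in> carrier_vec n" "w \<noteq> 0\<^sub>v n" "- (A *\<^sub>v w) = l \<cdot>\<^sub>v w"
      using A neg by (auto simp: eigenvalue_def eigenvector_def)
    have "A *\<^sub>v w = (- l) \<cdot>\<^sub>v w"
    proof (rule eq_vecI)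
      fix a assume "a < dim_vec ((- l) \<cdot>\<^sub>v w)"
      then show "(A *\<^sub>v w) $ a = ((- l) \<cdot>\<^sub>v w) $ a"
        using arg_cong[OF w(3), of "\<lambda>v. v $ a"] A w(1) by simp
    qed (use A w(1) in simp)
    then have "eigenvalue A (- l)" using w A by (auto simp: eigenvalue_def eigenvector_def)
    from ev[OF this] show "- c \<le> l" by simp
  qed
  then show ?thesis using neg[OF v] v A by simp
qed

section \<open>Random variables with a Gaussian moment generating function\<close>

lemma cosh_ge_partial_sum:
  fixes x :: real
  assumes "finite I"
  shows "(\<Sum>n\<in>I. if even n then x ^ n / fact n else 0) \<le> cosh x"
proof -
  have s: "(\<lambda>n. if even n then x ^ n /\<^sub>R fact n else 0) sums cosh x"
    by (rule cosh_converges)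
  have "(\<Sum>n\<in>I. if even n then x ^ n /\<^sub>R fact n else 0) \<le> cosh x"
    unfolding sums_unique[OF s]
    by (rule sum_le_suminf) (use s assms in \<open>auto simp: sums_iff zero_le_even_power\<close>)
  then show ?thesis by (simp add: divide_inverse mult.commute cong: if_cong)
qed

lemma cosh_ge_fourth_power:
  fixes x :: real
  shows "x ^ 4 \<le> 24 * cosh x"
  using cosh_ge_partial_sum[of "{4}" x] by (simp add: fact_numeral)

lemma cosh_ge_one_plus_half_square:
  fixes x :: real
  shows "1 + x\<^sup>2 / 2 \<le> cosh x"
  using cosh_ge_partial_sum[of "{0, 2}" x] by simp

lemma cosh_minus_one_le:
  fixes x :: real
  shows "\<bar>cosh x - 1\<bar> \<le> x ^ 2 / 2 * cosh x"
proof -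
  have "\<exists>t. \<bar>t\<bar> \<le> \<bar>x\<bar> \<and> cosh x = 1 + cosh t / 2 * x ^ 2" 
  proof -
    define diff where "diff m = (if even m then cosh else (sinh :: real \<Rightarrow> real))" for m :: nat
    have "\<exists>t. \<bar>t\<bar> \<le> \<bar>x\<bar> \<and> cosh x = (\<Sum>m<2. diff m 0 / fact m * x ^ m) + diff 2 t / fact 2 * x ^ 2"
      by (rule Maclaurin_bi_le) (auto simp: diff_def intro!: derivative_eq_intros)
    then show ?thesis by (simp add: diff_def numeral_2_eq_2)
  qed
  then obtain t where t: "\<bar>t\<bar> \<le> \<bar>x\<bar>" "cosh x = 1 + cosh t / 2 * x ^ 2" by auto
  have "cosh t \<le> cosh x"
    using t(1) cosh_real_nonneg_le_iff[of "\<bar>t\<bar>" "\<bar>x\<bar>"] by simp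
  then have "cosh t * x ^ 2 \<le> cosh x * x ^ 2" by (intro mult_right_mono) auto
  then show ?thesis using t(2) by (simp add: mult.commute)
qed

lemma cosh_minus_one_over_square_limit:
  fixes u :: real
  shows "((\<lambda>t. (cosh (t * u) - 1) / t\<^sup>2) \<longlongrightarrow> u\<^sup>2 / 2) (at_right 0)"
proof (cases "u = 0")
  case False
  have lim: "((\<lambda>x::real. (cosh x - 1) / x\<^sup>2) \<longlongrightarrow> 1 / 2) (at 0)"
    unfolding cosh_field_def by real_asymp
  from False have "filterlim (\<lambda>t. t * u) (at 0) (at_right 0)"
    unfolding filterlim_at by (auto intro!: tendsto_eq_intros simp: eventually_at_filter)
  from tendsto_mult[OF filterlim_compose[OF lim this] tendsto_const[of "u\<^sup>2"]] show ?thesis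
    using False by (simp add: power_mult_distrib)
qed auto

lemma exp_square_minus_one_over_square_limit:
  fixes v :: real
  shows "((\<lambda>t. (exp (t\<^sup>2 * v / 2) - 1) / t\<^sup>2) \<longlongrightarrow> v / 2) (at_right 0)"
proof -
  have "((\<lambda>h. exp (h * v / 2)) has_real_derivative v / 2) (at 0)"
    by (auto intro!: derivative_eq_intros)
  then have "((\<lambda>h. (exp (h * v / 2) - 1) / h) \<longlongrightarrow> v / 2) (at 0)"
    by (simp add: DERIV_def)
  moreover have "filterlim (\<lambda>t::real. t\<^sup>2) (at 0) (at_right 0)"
    unfolding filterlim_at by (auto intro!: tendsto_eq_intros simp: eventually_at_filter)
  ultimately show ?thesis by (rule filterlim_compose)
qed

text \<open>The law of \<open>U\<close> is \<open>N(0, v)\<close>, in the form that is easiest to derive from a multivariate density and to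
carry over to means. It covers the degenerate case \<open>v = 0\<close>, which occurs for the zero linear form.\<close>

definition gaussian_mgf :: "'a measure \<Rightarrow> ('a \<Rightarrow> real) \<Rightarrow> real \<Rightarrow> bool" where
  "gaussian_mgf M U v \<longleftrightarrow> U \<in> borel_measurable M \<and>
     (\<forall>t. has_bochner_integral M (\<lambda>x. exp (t * U x)) (exp (t\<^sup>2 * v / 2)))"

context prob_space
begin

lemma gaussian_mgf_cosh:
  assumes "gaussian_mgf M U v"
  shows "has_bochner_integral M (\<lambda>x. cosh (t * U x)) (exp (t\<^sup>2 * v / 2))"
proof -
  have "has_bochner_integral M (\<lambda>x. (exp (t * U x) + exp (- t * U x)) / 2)
      ((exp (t\<^sup>2 * v / 2) + exp ((- t)\<^sup>2 * v / 2)) / 2)"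
    using assms unfolding gaussian_mgf_def
    by (intro has_bochner_integral_divide_zero has_bochner_integral_add) blast+
  then show ?thesis by (simp add: cosh_def)
qed

text \<open>Bound \<open>(t U)\<^sup>4\<close> by \<open>24 cosh (t U)\<close> with \<open>t = 1 / sqrt L\<close>. An upper bound \<open>L > 0\<close> in place of \<open>v\<close> keeps
\<open>t\<close> meaningful when \<open>v = 0\<close>.\<close>

lemma gaussian_mgf_fourth_moment:
  assumes U: "gaussian_mgf M U v" and L: "v \<le> L" "L > 0"
  shows "integrable M (\<lambda>x. U x ^ 4)" "expectation (\<lambda>x. U x ^ 4) \<le> 48 * L\<^sup>2"
proof -
  have [measurable]: "U \<in> borel_measurable M" using U by (simp add: gaussian_mgf_def)
  define t where "t = 1 / sqrt L"
  have t2: "t\<^sup>2 = 1 / L" and t4: "t ^ 4 = 1 / L\<^sup>2" and t0: "t > 0"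
    using L(2) by (auto simp: t_def power_divide power4_eq_xxxx power2_eq_square)
  have le: "U x ^ 4 \<le> 24 * L\<^sup>2 * cosh (t * U x)" for x
    using cosh_ge_fourth_power[of "t * U x"] L(2) t4 by (simp add: power_mult_distrib field_simps)
  note c = gaussian_mgf_cosh[OF U, of t]
  have ci: "integrable M (\<lambda>x. 24 * L\<^sup>2 * cosh (t * U x))"
    using c by (auto simp: has_bochner_integral_iff)
  show i: "integrable M (\<lambda>x. U x ^ 4)"
    by (rule Bochner_Integration.integrable_bound[OF ci]) (use le in auto)
  have "expectation (\<lambda>x. U x ^ 4) \<le> expectation (\<lambda>x. 24 * L\<^sup>2 * cosh (t * U x))"
    using i ci le by (intro integral_mono) auto
  also have "\<dots> = 24 * L\<^sup>2 * exp (v / L / 2)"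
    using c t2 by (simp add: has_bochner_integral_iff)
  also have "\<dots> \<le> 24 * L\<^sup>2 * 2"
  proof (intro mult_left_mono)
    have "exp (v / L / 2) \<le> exp (1 / 2)" using L by (simp add: field_simps)
    also have "\<dots> \<le> 1 + 1 / 2 + (1 / 2)\<^sup>2" by (rule exp_bound) auto
    also have "\<dots> \<le> (2 :: real)" by (simp add: power2_eq_square)
    finally show "exp (v / L / 2) \<le> 2" .
  qed (use L in auto)
  finally show "expectation (\<lambda>x. U x ^ 4) \<le> 48 * L\<^sup>2" by simp
qed

lemma gaussian_mgf_square_integrable:
  assumes U: "gaussian_mgf M U v"
  shows "integrable M (\<lambda>x. (U x)\<^sup>2)"
proof -
  have [measurable]: "U \<in> borel_measurable M" using U by (simp add: gaussian_mgf_def)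
  have "integrable M (\<lambda>x. ((U x)\<^sup>2)\<^sup>2)"
    using gaussian_mgf_fourth_moment(1)[OF U, of "max v 1"] by (simp flip: power_mult)
  then show ?thesis
    by (intro square_integrable_imp_integrable[of "\<lambda>x. (U x)\<^sup>2"]) auto
qed

text \<open>As \<open>t\<close> tends to 0, \<open>(cosh (t U) - 1) / t\<^sup>2\<close> converges to \<open>U\<^sup>2 / 2\<close>, dominated by \<open>cosh (2 U)\<close>, while its
expectation \<open>(exp (t\<^sup>2 v / 2) - 1) / t\<^sup>2\<close> converges to \<open>v / 2\<close>.\<close>

lemma gaussian_mgf_variance:
  assumes U: "gaussian_mgf M U v"
  shows "expectation (\<lambda>x. (U x)\<^sup>2) = v"
proof -
  have [measurable]: "U \<in> borel_measurable M" using U by (simp add: gaussian_mgf_def)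
  define t where "t n = 1 / real (Suc n)" for n
  have t0: "t n > 0" "t n \<le> 1" for n by (auto simp: t_def)
  have tlim: "filterlim t (at_right 0) sequentially" unfolding t_def by real_asymp
  have dom: "norm ((cosh (t n * u) - 1) / (t n)\<^sup>2) \<le> cosh (2 * u)" for n and u :: real
  proof -
    have "\<bar>cosh (t n * u) - 1\<bar> \<le> (t n * u)\<^sup>2 / 2 * cosh (t n * u)" by (rule cosh_minus_one_le)
    also have "\<dots> \<le> (t n * u)\<^sup>2 / 2 * cosh u"
    proof (intro mult_left_mono)
      have "\<bar>t n * u\<bar> \<le> \<bar>u\<bar>" using t0[of n] by (simp add: abs_mult mult_left_le_one_le)
      then show "cosh (t n * u) \<le> cosh u"
        using cosh_real_nonneg_le_iff[of "\<bar>t n * u\<bar>" "\<bar>u\<bar>"] by simp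
    qed auto
    finally have 1: "\<bar>cosh (t n * u) - 1\<bar> / (t n)\<^sup>2 \<le> u\<^sup>2 / 2 * cosh u"
      using t0[of n] by (simp add: field_simps power_mult_distrib)
    have "u\<^sup>2 / 2 \<le> cosh u" using cosh_ge_one_plus_half_square[of u] by linarith
    then have "u\<^sup>2 / 2 * cosh u \<le> cosh u * cosh u" by (intro mult_right_mono) auto
    also have "\<dots> \<le> cosh (2 * u)"
      by (simp add: cosh_double power2_eq_square)
    finally show ?thesis using order_trans[OF 1] t0[of n] by (simp only: real_norm_def abs_divide) simp
  qed
  have cosh_measurable: "(\<lambda>x. cosh (s * U x)) \<in> borel_measurable M" for s
    using gaussian_mgf_cosh[OF U] by (rule borel_measurable_has_bochner_integral)
  have lim2: "(\<lambda>n. expectation (\<lambda>x. (cosh (t n * U x) - 1) / (t n)\<^sup>2)) \<longlonglongrightarrow> expectation (\<lambda>x. (U x)\<^sup>2 / 2)"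
  proof (rule integral_dominated_convergence)
    show "integrable M (\<lambda>x. cosh (2 * U x))"
      using gaussian_mgf_cosh[OF U, of 2] by (auto simp: has_bochner_integral_iff)
    show "AE x in M. (\<lambda>n. (cosh (t n * U x) - 1) / (t n)\<^sup>2) \<longlonglongrightarrow> (U x)\<^sup>2 / 2"
      by (intro AE_I2 filterlim_compose[OF cosh_minus_one_over_square_limit tlim])
    show "AE x in M. norm ((cosh (t n * U x) - 1) / (t n)\<^sup>2) \<le> cosh (2 * U x)" for n
      by (intro AE_I2 dom)
    show "(\<lambda>x. (cosh (t n * U x) - 1) / (t n)\<^sup>2) \<in> borel_measurable M" for n
      using cosh_measurable by (intro borel_measurable_divide borel_measurable_diff borel_measurable_const)
  qed simp
  have "expectation (\<lambda>x. (cosh (t n * U x) - 1) / (t n)\<^sup>2) = (exp ((t n)\<^sup>2 * v / 2) - 1) / (t n)\<^sup>2" for n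
    using gaussian_mgf_cosh[OF U, of "t n"] by (simp add: has_bochner_integral_iff prob_space)
  then have "(\<lambda>n. expectation (\<lambda>x. (cosh (t n * U x) - 1) / (t n)\<^sup>2)) \<longlonglongrightarrow> v / 2"
    using filterlim_compose[OF exp_square_minus_one_over_square_limit tlim] by (simp only:)
  then have "v / 2 = expectation (\<lambda>x. (U x)\<^sup>2 / 2)" using lim2 by (rule LIMSEQ_unique)
  then show ?thesis by simp
qed

section \<open>Mean square error of the sample variance\<close>

lemma gaussian_mgf_sample_mean:
  assumes ind: "indep_vars (\<lambda>_. borel) U {..<n}" and n: "n \<ge> 1"
    and U: "\<And>k. k < n \<Longrightarrow> gaussian_mgf M (U k) v"
  shows "gaussian_mgf M (\<lambda>x. (\<Sum>k<n. U k x) / real n) (v / real n)"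
  unfolding gaussian_mgf_def
proof (intro conjI allI)
  have m: "U k \<in> borel_measurable M" if "k < n" for k
    using U[OF that] by (simp add: gaussian_mgf_def)
  then show "(\<lambda>x. (\<Sum>k<n. U k x) / real n) \<in> borel_measurable M" by measurable
  fix t :: real
  let ?E = "\<lambda>k x. exp (t / real n * U k x)"
  have indE: "indep_vars (\<lambda>_. borel) ?E {..<n}"
    by (rule indep_vars_compose2[OF ind]) measurable
  have E: "has_bochner_integral M (?E k) (exp ((t / real n)\<^sup>2 * v / 2))" if "k < n" for k
    using U[OF that] unfolding gaussian_mgf_def by blast
  have "has_bochner_integral M (\<lambda>x. \<Prod>k<n. ?E k x) (\<Prod>k<n. exp ((t / real n)\<^sup>2 * v / 2))"
    using E indep_vars_lebesgue_integral[OF _ indE] indep_vars_integrable[OF _ indE]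
    by (auto simp: has_bochner_integral_iff)
  moreover have "(\<Prod>k<n. ?E k x) = exp (t * ((\<Sum>k<n. U k x) / real n))" for x
    by (simp add: exp_sum[symmetric] sum_distrib_left sum_divide_distrib)
  moreover have "(\<Prod>k<n. exp ((t / real n)\<^sup>2 * v / 2)) = exp (t\<^sup>2 * (v / real n) / 2)"
    using n by (simp add: exp_of_nat_mult[symmetric] power_divide) (simp add: power2_eq_square)
  ultimately show "has_bochner_integral M (\<lambda>x. exp (t * ((\<Sum>k<n. U k x) / real n)))
      (exp (t\<^sup>2 * (v / real n) / 2))"
    by (simp only:)
qed

lemma second_moment_sum_indep_centered:
  fixes Z :: "nat \<Rightarrow> 'a \<Rightarrow> real"
  assumes ind: "indep_vars (\<lambda>_. borel) Z {..<n}"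
    and i2: "\<And>k. k < n \<Longrightarrow> integrable M (\<lambda>x. (Z k x)\<^sup>2)"
    and mean: "\<And>k. k < n \<Longrightarrow> expectation (Z k) = 0"
  shows "integrable M (\<lambda>x. (\<Sum>k<n. Z k x)\<^sup>2)"
    "expectation (\<lambda>x. (\<Sum>k<n. Z k x)\<^sup>2) = (\<Sum>k<n. expectation (\<lambda>x. (Z k x)\<^sup>2))"
proof -
  have m: "Z k \<in> borel_measurable M" if "k < n" for k
    using ind that by (auto simp: indep_vars_def)
  have i1: "integrable M (Z k)" if "k < n" for k
    by (rule square_integrable_imp_integrable[OF m[OF that] i2[OF that]])
  have c: "integrable M (\<lambda>x. Z j x * Z k x)"
    "expectation (\<lambda>x. Z j x * Z k x) = (if j = k then expectation (\<lambda>x. (Z k x)\<^sup>2) else 0)"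
    if jk: "j < n" "k < n" for j k
  proof -
    have "integrable M (\<lambda>x. Z j x * Z k x) \<and> expectation (\<lambda>x. Z j x * Z k x) = 0" if "j \<noteq> k"
    proof -
      have ind2: "indep_vars (\<lambda>_. borel) Z {j, k}"
        by (rule indep_vars_subset[OF ind]) (use jk in auto)
      have ii: "integrable M (Z l)" if "l \<in> {j, k}" for l using that jk i1 by auto
      have "finite {j, k}" by simp
      note r = indep_vars_integrable[OF this ind2 ii] indep_vars_lebesgue_integral[OF this ind2 ii]
      show ?thesis using r \<open>j \<noteq> k\<close> mean jk by simp
    qed
    moreover have "integrable M (\<lambda>x. Z k x * Z k x)"
      using i2[OF jk(2)] by (simp add: power2_eq_square)
    ultimately show "integrable M (\<lambda>x. Z j x * Z k x)"
      "expectation (\<lambda>x. Z j x * Z k x) = (if j = k then expectation (\<lambda>x. (Z k x)\<^sup>2) else 0)"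
      by (cases "j = k"; simp add: power2_eq_square)+
  qed
  have sq: "(\<Sum>k<n. Z k x)\<^sup>2 = (\<Sum>j<n. \<Sum>k<n. Z j x * Z k x)" for x
    by (simp add: power2_eq_square sum_product)
  show "integrable M (\<lambda>x. (\<Sum>k<n. Z k x)\<^sup>2)"
    unfolding sq by (intro Bochner_Integration.integrable_sum c) auto
  have "expectation (\<lambda>x. (\<Sum>k<n. Z k x)\<^sup>2) = (\<Sum>j<n. \<Sum>k<n. expectation (\<lambda>x. Z j x * Z k x))"
    unfolding sq by (subst Bochner_Integration.integral_sum; (intro sum.cong refl Bochner_Integration.integral_sum Bochner_Integration.integrable_sum c)?; simp)
  also have "\<dots> = (\<Sum>j<n. \<Sum>k<n. if j = k then expectation (\<lambda>x. (Z k x)\<^sup>2) else 0)"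
    by (intro sum.cong refl) (simp add: c)
  also have "\<dots> = (\<Sum>k<n. expectation (\<lambda>x. (Z k x)\<^sup>2))"
    by (simp add: sum.delta)
  finally show "expectation (\<lambda>x. (\<Sum>k<n. Z k x)\<^sup>2) = (\<Sum>k<n. expectation (\<lambda>x. (Z k x)\<^sup>2))" .
qed

lemma gaussian_mean_square_deviation:
  assumes ind: "indep_vars (\<lambda>_. borel) U {..<n}" and n: "n \<ge> 1"
    and U: "\<And>k. k < n \<Longrightarrow> gaussian_mgf M (U k) v" and L: "v \<le> L" "L > 0"
  shows "integrable M (\<lambda>x. ((\<Sum>k<n. (U k x)\<^sup>2) / real n - v)\<^sup>2)"
    "expectation (\<lambda>x. ((\<Sum>k<n. (U k x)\<^sup>2) / real n - v)\<^sup>2) \<le> 48 * L\<^sup>2 / real n"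
proof -
  define Z where "Z k x = (U k x)\<^sup>2 - v" for k x
  have sqZ: "(Z k x)\<^sup>2 = U k x ^ 4 - 2 * v * (U k x)\<^sup>2 + v\<^sup>2" for k x
    by (simp add: Z_def power2_diff flip: power_mult)
  have indZ: "indep_vars (\<lambda>_. borel) Z {..<n}"
    unfolding Z_def by (rule indep_vars_compose2[OF ind]) measurable
  have i2: "integrable M (\<lambda>x. (Z k x)\<^sup>2)" and e2: "expectation (\<lambda>x. (Z k x)\<^sup>2) \<le> 48 * L\<^sup>2"
    and e1: "expectation (Z k) = 0" if "k < n" for k
  proof -
    note U4 = gaussian_mgf_fourth_moment[OF U[OF that] L]
    note U2 = gaussian_mgf_square_integrable[OF U[OF that]] gaussian_mgf_variance[OF U[OF that]]
    show "integrable M (\<lambda>x. (Z k x)\<^sup>2)"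
      unfolding sqZ using U4(1) U2(1) by (intro Bochner_Integration.integrable_add
        Bochner_Integration.integrable_diff integrable_mult_right) auto
    have "expectation (\<lambda>x. (Z k x)\<^sup>2) = expectation (\<lambda>x. U k x ^ 4) - v\<^sup>2"
      unfolding sqZ using U4(1) U2 by (simp add: prob_space power2_eq_square)
    then show "expectation (\<lambda>x. (Z k x)\<^sup>2) \<le> 48 * L\<^sup>2" 
      using U4(2) zero_le_power2[of v] by linarith
    show "expectation (Z k) = 0" unfolding Z_def using U2 by (simp add: prob_space)
  qed
  note S = second_moment_sum_indep_centered[OF indZ i2 e1]
  have eq: "((\<Sum>k<n. (U k x)\<^sup>2) / real n - v)\<^sup>2 = (\<Sum>k<n. Z k x)\<^sup>2 / (real n)\<^sup>2" for x
    using n by (simp add: Z_def sum_subtractf field_simps flip: power_divide)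
  show "integrable M (\<lambda>x. ((\<Sum>k<n. (U k x)\<^sup>2) / real n - v)\<^sup>2)"
    unfolding eq by (intro integrable_divide_zero S(1)) auto
  have "expectation (\<lambda>x. ((\<Sum>k<n. (U k x)\<^sup>2) / real n - v)\<^sup>2)
      = (\<Sum>k<n. expectation (\<lambda>x. (Z k x)\<^sup>2)) / (real n)\<^sup>2"
    unfolding eq integral_divide_zero using S(2) by simp
  also have "\<dots> \<le> (\<Sum>k<n. 48 * L\<^sup>2) / (real n)\<^sup>2"
    by (intro divide_right_mono sum_mono e2) auto
  also have "\<dots> = 48 * L\<^sup>2 / real n"
    using n by (simp add: power2_eq_square)
  finally show "expectation (\<lambda>x. ((\<Sum>k<n. (U k x)\<^sup>2) / real n - v)\<^sup>2) \<le> 48 * L\<^sup>2 / real n" .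
qed

text \<open>With \<open>W\<close> the mean of the \<open>U k\<close> and \<open>A\<close> the error of the mean of their squares,
\<open>T - v = n / (n - 1) * (A - (W\<^sup>2 - v / n))\<close>. The second moment of \<open>A\<close> is of order \<open>1 / n\<close>. The mean \<open>W\<close>
again has a Gaussian moment generating function, now with variance \<open>v / n\<close>, so that \<open>W\<^sup>4\<close> has
expectation of order \<open>1 / n\<^sup>2\<close> and the correction for the unknown mean is negligible.\<close>

lemma gaussian_sample_variance_deviation:
  fixes U :: "nat \<Rightarrow> 'a \<Rightarrow> real"
  assumes ind: "indep_vars (\<lambda>_. borel) U {..<n}" and n: "n \<ge> 2"
    and U: "\<And>k. k < n \<Longrightarrow> gaussian_mgf M (U k) v" and L: "0 \<le> v" "v \<le> L" "L > 0"
  defines "T \<equiv> \<lambda>x. (\<Sum>k<n. (U k x - (\<Sum>k<n. U k x) / real n)\<^sup>2) / (real n - 1)"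
  shows "integrable M (\<lambda>x. (T x - v)\<^sup>2)"
    "expectation (\<lambda>x. (T x - v)\<^sup>2) \<le> 580 * L\<^sup>2 / real n"
proof -
  have n1: "n \<ge> 1" using n by simp
  define W where "W x = (\<Sum>k<n. U k x) / real n" for x
  define A where "A x = (\<Sum>k<n. (U k x)\<^sup>2) / real n - v" for x
  have m[measurable]: "U k \<in> borel_measurable M" if "k < n" for k
    using U[OF that] by (simp add: gaussian_mgf_def)
  have [measurable]: "T \<in> borel_measurable M" unfolding T_def by measurable
  have W: "gaussian_mgf M W (v / real n)"
    unfolding W_def by (rule gaussian_mgf_sample_mean[OF ind n1 U])
  have "v / real n \<le> L / real n" "L / real n > 0" using L n by (auto simp: divide_right_mono)
  note W4 = gaussian_mgf_fourth_moment[OF W this]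
  note A2 = gaussian_mean_square_deviation[OF ind n1 U L(2,3), folded A_def]
  have T: "T x - v = real n / (real n - 1) * (A x - ((W x)\<^sup>2 - v / real n))" for x
  proof -
    have s: "(\<Sum>k<n. U k x) = real n * W x" using n by (simp add: W_def)
    have "(\<Sum>k<n. (U k x - W x)\<^sup>2) = (\<Sum>k<n. (U k x)\<^sup>2) - 2 * W x * (\<Sum>k<n. U k x) + real n * (W x)\<^sup>2"
      by (simp add: power2_diff sum.distrib sum_subtractf sum_distrib_left sum_distrib_right mult_ac)
    also have "\<dots> = real n * (A x + v) - real n * (W x)\<^sup>2"
      unfolding s using n by (simp add: A_def power2_eq_square)
    finally have e: "(\<Sum>k<n. (U k x - W x)\<^sup>2) = real n * (A x + v) - real n * (W x)\<^sup>2" .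
    have "real n \<noteq> 0" "real n - 1 \<noteq> 0" using n by auto
    then show ?thesis
      unfolding T_def W_def[symmetric] e by (simp add: divide_simps) (simp add: algebra_simps)
  qed
  have le: "(T x - v)\<^sup>2 \<le> 8 * (A x)\<^sup>2 + 8 * (W x ^ 4 + (L / real n)\<^sup>2)" for x
  proof -
    have r: "real n / (real n - 1) \<le> 2" "0 \<le> real n / (real n - 1)" using n by (auto simp: field_simps)
    have d: "0 \<le> v / real n" "v / real n \<le> L / real n" using L n by (auto simp: divide_right_mono)
    have "(A x - ((W x)\<^sup>2 - v / real n))\<^sup>2 \<le> 2 * (A x)\<^sup>2 + 2 * ((W x)\<^sup>2 - v / real n)\<^sup>2"
      using zero_le_power2[of "A x + ((W x)\<^sup>2 - v / real n)"] by (simp add: power2_sum power2_diff)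
    also have "((W x)\<^sup>2 - v / real n)\<^sup>2 \<le> ((W x)\<^sup>2)\<^sup>2 + (v / real n)\<^sup>2"
      using d mult_nonneg_nonneg[of "(W x)\<^sup>2" "v / real n"] unfolding power2_diff by simp
    also have "(v / real n)\<^sup>2 \<le> (L / real n)\<^sup>2" using d by (intro power_mono)
    finally have b: "(A x - ((W x)\<^sup>2 - v / real n))\<^sup>2 \<le> 2 * (A x)\<^sup>2 + 2 * (W x ^ 4 + (L / real n)\<^sup>2)"
      by (simp flip: power_mult)
    have "(T x - v)\<^sup>2 = (real n / (real n - 1))\<^sup>2 * (A x - ((W x)\<^sup>2 - v / real n))\<^sup>2"
      unfolding T power_mult_distrib ..
    also have "\<dots> \<le> 2\<^sup>2 * (2 * (A x)\<^sup>2 + 2 * (W x ^ 4 + (L / real n)\<^sup>2))"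
      by (intro mult_mono b power_mono r) auto
    finally show ?thesis by simp
  qed
  (* The constant is 8 * (48 + 49 / 2), where the 1 / 2 comes from 1 / n^2 \<le> 1 / (2 n). *)
  let ?b = "\<lambda>x. 8 * (A x)\<^sup>2 + 8 * (W x ^ 4 + (L / real n)\<^sup>2)"
  have ib: "integrable M ?b" using A2(1) W4(1) by simp
  show i: "integrable M (\<lambda>x. (T x - v)\<^sup>2)"
    by (rule Bochner_Integration.integrable_bound[OF ib]) (use le in \<open>auto intro: order_trans\<close>)
  have "expectation (\<lambda>x. (T x - v)\<^sup>2) \<le> expectation ?b" by (intro integral_mono i ib le)
  also have "\<dots> = 8 * expectation (\<lambda>x. (A x)\<^sup>2) + 8 * (expectation (\<lambda>x. W x ^ 4) + (L / real n)\<^sup>2)"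
    using A2(1) W4(1) by (simp add: prob_space)
  also have "\<dots> \<le> 8 * (48 * L\<^sup>2 / real n) + 8 * (48 * (L / real n)\<^sup>2 + (L / real n)\<^sup>2)"
    using A2(2) W4(2) by simp
  also have "(L / real n)\<^sup>2 \<le> L\<^sup>2 / real n / 2"
    using n L by (simp add: power_divide power2_eq_square field_simps)
  finally have "expectation (\<lambda>x. (T x - v)\<^sup>2) \<le> 580 * (L\<^sup>2 / real n)"
    by simp
  then show "expectation (\<lambda>x. (T x - v)\<^sup>2) \<le> 580 * L\<^sup>2 / real n" by simp
qed

end

section \<open>Linear forms of a Gaussian vector\<close>

lemma distr_PiM_lborel_translation:
  assumes "finite I"
  shows "distr (Pi\<^sub>M I (\<lambda>_. lborel :: real measure)) (Pi\<^sub>M I (\<lambda>_. lborel)) (\<lambda>x. \<lambda>a\<in>I. x a + c a) = Pi\<^sub>M I (\<lambda>_. lborel)"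
proof (rule product_sigma_finite.PiM_eqI)
  interpret product_sigma_finite "\<lambda>_. lborel :: real measure" ..
  show "product_sigma_finite (\<lambda>_. lborel :: real measure)" ..
  show "finite I" by fact
  show "sets (distr (Pi\<^sub>M I (\<lambda>_. lborel :: real measure)) (Pi\<^sub>M I (\<lambda>_. lborel)) (\<lambda>x. \<lambda>a\<in>I. x a + c a))
      = sets (Pi\<^sub>M I (\<lambda>_. lborel))" by simp
  fix A :: "_ \<Rightarrow> real set" assume A: "\<And>i. i \<in> I \<Longrightarrow> A i \<in> sets lborel"
  have m: "(\<lambda>x. \<lambda>a\<in>I. x a + c a) \<in> Pi\<^sub>M I (\<lambda>_. lborel :: real measure) \<rightarrow>\<^sub>M Pi\<^sub>M I (\<lambda>_. lborel)"
    by measurable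
  have mp: "(\<lambda>y. y + c i) \<in> lborel \<rightarrow>\<^sub>M (lborel :: real measure)" for i by measurable
  have s: "(\<lambda>y. y + c i) -` A i \<in> sets lborel" if "i \<in> I" for i
    using measurable_sets[OF mp A[OF that]] by simp
  have "emeasure (distr (Pi\<^sub>M I (\<lambda>_. lborel)) (Pi\<^sub>M I (\<lambda>_. lborel)) (\<lambda>x. \<lambda>a\<in>I. x a + c a)) (Pi\<^sub>E I A)
     = emeasure (Pi\<^sub>M I (\<lambda>_. lborel)) ((\<lambda>x. \<lambda>a\<in>I. x a + c a) -` Pi\<^sub>E I A \<inter> space (Pi\<^sub>M I (\<lambda>_. lborel)))"
    using assms A by (intro emeasure_distr m sets_PiM_I_finite)
  also have "(\<lambda>x. \<lambda>a\<in>I. x a + c a) -` Pi\<^sub>E I A \<inter> space (Pi\<^sub>M I (\<lambda>_. lborel))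
      = (\<Pi>\<^sub>E i\<in>I. (\<lambda>y. y + c i) -` A i)"
    by (auto simp: space_PiM PiE_iff)
  also have "emeasure (Pi\<^sub>M I (\<lambda>_. lborel)) \<dots> = (\<Prod>i\<in>I. emeasure lborel ((\<lambda>y. y + c i) -` A i))"
    using assms s by (intro emeasure_PiM)
  also have "\<dots> = (\<Prod>i\<in>I. emeasure lborel (A i))"
  proof (rule prod.cong)
    fix i assume i: "i \<in> I"
    have "emeasure lborel (A i) = emeasure (distr lborel lborel (\<lambda>y. y + c i)) (A i)"
      using lborel_distr_plus[of "c i"] by (simp add: add.commute cong: distr_cong)
    also have "\<dots> = emeasure lborel ((\<lambda>y. y + c i) -` A i)"
      using A[OF i] by (subst emeasure_distr[OF mp]) auto
    finally show "emeasure lborel ((\<lambda>y. y + c i) -` A i) = emeasure lborel (A i)" ..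
  qed simp
  finally show "emeasure (distr (Pi\<^sub>M I (\<lambda>_. lborel)) (Pi\<^sub>M I (\<lambda>_. lborel)) (\<lambda>x. \<lambda>a\<in>I. x a + c a)) (Pi\<^sub>E I A)
     = (\<Prod>i\<in>I. emeasure lborel (A i))" .
qed

lemma scalar_prod_centered:
  fixes v \<mu> :: "real vec"
  assumes "\<mu> \<in> carrier_vec p"
  shows "v \<bullet> (vec p x - \<mu>) = (\<Sum>a<p. v $ a * (x a - \<mu> $ a))"
  using assms by (simp add: scalar_prod_def lessThan_atLeast0)

text \<open>Completing the square: with \<open>d = x - \<mu>\<close> and \<open>w = - \<Sigma> u\<close>,
\<open>- d\<^sup>T \<Sigma>\<^sup>-\<^sup>1 d / 2 + u\<^sup>T d = u\<^sup>T \<Sigma> u / 2 - (d + w)\<^sup>T \<Sigma>\<^sup>-\<^sup>1 (d + w) / 2\<close>.\<close>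

lemma mvn_density_translate:
  fixes \<Sigma> :: "real mat"
  assumes mu: "\<mu> \<in> carrier_vec p" and S: "\<Sigma> \<in> carrier_mat p p" "pos_def_mat \<Sigma>" and u: "u \<in> carrier_vec p"
  shows "mvn_density \<mu> \<Sigma> x * exp (u \<bullet> (vec p x - \<mu>))
    = exp (u \<bullet> (\<Sigma> *\<^sub>v u) / 2) * mvn_density \<mu> \<Sigma> (\<lambda>a\<in>{..<p}. x a + (- (\<Sigma> *\<^sub>v u)) $ a)"
proof -
  define d where "d = vec p x - \<mu>"
  define w where "w = - (\<Sigma> *\<^sub>v u)"
  note I = pos_def_mat_inverse[OF S]
  have d: "d \<in> carrier_vec p" and w: "w \<in> carrier_vec p" using mu S u by (auto simp: d_def w_def)
  have Iw: "inv_mat \<Sigma> *\<^sub>v w = - u"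
  proof -
    have "inv_mat \<Sigma> *\<^sub>v w = (-1) \<cdot>\<^sub>v (inv_mat \<Sigma> *\<^sub>v (\<Sigma> *\<^sub>v u))"
      unfolding w_def using I(1) S(1) u by (subst mult_mat_vec[symmetric]) auto
    also have "inv_mat \<Sigma> *\<^sub>v (\<Sigma> *\<^sub>v u) = u"
      using I S(1) u by (simp add: assoc_mult_mat_vec[symmetric])
    also have "(-1) \<cdot>\<^sub>v u = - u" by (rule eq_vecI) auto
    finally show ?thesis .
  qed
  have dw: "vec p (\<lambda>a\<in>{..<p}. x a + w $ a) - \<mu> = d + w"
    using mu w by (intro eq_vecI) (auto simp: d_def)
  have "(d + w) \<bullet> (inv_mat \<Sigma> *\<^sub>v (d + w))
     = d \<bullet> (inv_mat \<Sigma> *\<^sub>v d) + 2 * (d \<bullet> (inv_mat \<Sigma> *\<^sub>v w)) + w \<bullet> (inv_mat \<Sigma> *\<^sub>v w)"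
    using I d w by (intro quadratic_form_add)
  also have "\<dots> = d \<bullet> (inv_mat \<Sigma> *\<^sub>v d) - 2 * (u \<bullet> d) + u \<bullet> (\<Sigma> *\<^sub>v u)"
    unfolding Iw using d u S(1) comm_scalar_prod[OF d u] comm_scalar_prod[of "\<Sigma> *\<^sub>v u" p u]
    by (simp add: w_def)
  finally have q: "- (d \<bullet> (inv_mat \<Sigma> *\<^sub>v d)) / 2 + u \<bullet> d
     = u \<bullet> (\<Sigma> *\<^sub>v u) / 2 + - ((d + w) \<bullet> (inv_mat \<Sigma> *\<^sub>v (d + w))) / 2" by linarith
  have dim: "dim_vec \<mu> = p" using mu by simp
  have "exp (- (d \<bullet> (inv_mat \<Sigma> *\<^sub>v d)) / 2) * exp (u \<bullet> d)
     = exp (u \<bullet> (\<Sigma> *\<^sub>v u) / 2) * exp (- ((d + w) \<bullet> (inv_mat \<Sigma> *\<^sub>v (d + w))) / 2)"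
    unfolding exp_add[symmetric] q ..
  then show ?thesis
    unfolding mvn_density_def Let_def dim w_def[symmetric] dw d_def[symmetric]
    by (simp only: times_divide_eq_left times_divide_eq_right)
qed

context prob_space
begin

text \<open>Multiplying the density by \<open>exp (t u\<^sup>T (x - \<mu>))\<close> turns it into a translate of itself times the claimed
value, and the translate still integrates to 1.\<close>

lemma mvn_linear_form_gaussian_mgf:
  assumes mu: "\<mu> \<in> carrier_vec p" and S: "\<Sigma> \<in> carrier_mat p p" "pos_def_mat \<Sigma>"
    and u: "u \<in> carrier_vec p" and X: "mvn_distributed M X \<mu> \<Sigma>"
  shows "gaussian_mgf M (\<lambda>\<omega>. u \<bullet> (vec p (X \<omega>) - \<mu>)) (u \<bullet> (\<Sigma> *\<^sub>v u))"
proof -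
  let ?N = "Pi\<^sub>M {..<p} (\<lambda>_. lborel :: real measure)"
  let ?f = "\<lambda>x. ennreal (mvn_density \<mu> \<Sigma> x)"
  have dim: "dim_vec \<mu> = p" using mu by simp
  have D: "distributed M ?N X ?f" using X unfolding mvn_distributed_def dim .
  note Xm[measurable] = distributed_measurable[OF D]
  note fm[measurable] = distributed_borel_measurable[OF D]
  note lin = scalar_prod_centered[OF mu]
  have lm[measurable]: "(\<lambda>x. v \<bullet> (vec p x - \<mu>)) \<in> borel_measurable ?N" for v
    unfolding lin by measurable
  have total: "(\<integral>\<^sup>+x. ?f x \<partial>?N) = 1"
    using distributed_nn_integral[OF D, of "\<lambda>_. 1"] by (simp add: emeasure_space_1)
  show ?thesis
    unfolding gaussian_mgf_def
  proof (intro conjI allI)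
    show U: "(\<lambda>\<omega>. u \<bullet> (vec p (X \<omega>) - \<mu>)) \<in> borel_measurable M" by measurable
    fix t :: real
    let ?e = "exp (t\<^sup>2 * (u \<bullet> (\<Sigma> *\<^sub>v u)) / 2)"
    let ?\<tau> = "\<lambda>x. \<lambda>a\<in>{..<p}. x a + (- (\<Sigma> *\<^sub>v (t \<cdot>\<^sub>v u))) $ a"
    have tu: "t \<cdot>\<^sub>v u \<in> carrier_vec p" using u by simp
    have sc: "(t \<cdot>\<^sub>v u) \<bullet> (\<Sigma> *\<^sub>v (t \<cdot>\<^sub>v u)) = t\<^sup>2 * (u \<bullet> (\<Sigma> *\<^sub>v u))"
      using u S(1) by (simp add: mult_mat_vec[OF S(1) u] power2_eq_square)
    have tx: "t * (u \<bullet> (vec p x - \<mu>)) = (t \<cdot>\<^sub>v u) \<bullet> (vec p x - \<mu>)" for x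
      using u mu by (simp add: lin sum_distrib_left mult.assoc)
    have "(\<integral>\<^sup>+\<omega>. ennreal (exp (t * (u \<bullet> (vec p (X \<omega>) - \<mu>)))) \<partial>M)
        = (\<integral>\<^sup>+x. ?f x * ennreal (exp (t * (u \<bullet> (vec p x - \<mu>)))) \<partial>?N)"
      by (subst distributed_nn_integral[OF D, symmetric]) auto
    also have "\<dots> = (\<integral>\<^sup>+x. ennreal ?e * ?f (?\<tau> x) \<partial>?N)"
      unfolding tx using mvn_density_translate[OF mu S tu]
      by (intro nn_integral_cong) (simp add: ennreal_mult''[symmetric] ennreal_mult'[symmetric] sc)
    also have "\<dots> = ennreal ?e * (\<integral>\<^sup>+x. ?f (?\<tau> x) \<partial>?N)"
      by (intro nn_integral_cmult) measurable
    also have "(\<integral>\<^sup>+x. ?f (?\<tau> x) \<partial>?N) = (\<integral>\<^sup>+x. ?f x \<partial>distr ?N ?N ?\<tau>)"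
      by (subst nn_integral_distr) auto
    also have "\<dots> = 1" using total by (subst distr_PiM_lborel_translation) auto
    finally show "has_bochner_integral M (\<lambda>\<omega>. exp (t * (u \<bullet> (vec p (X \<omega>) - \<mu>)))) ?e"
      using U by (intro has_bochner_integral_nn_integral) auto
  qed
qed

end

section \<open>Deviation of the sample covariance matrix\<close>

lemma sample_cov_carrier: "sample_cov p n x \<in> carrier_mat p p"
  by (simp add: sample_cov_def)

lemma sample_cov_symmetric: "transpose_mat (sample_cov p n x) = sample_cov p n x"
  by (rule eq_matI) (auto simp: sample_cov_def mult.commute)

text \<open>The shift by \<open>\<mu>\<close> cancels against the sample mean. It is there because the centered linear forms are
those with a Gaussian moment generating function.\<close>

lemma sample_cov_quadratic_form:
  fixes u \<mu> :: "real vec" and x :: "nat \<Rightarrow> nat \<Rightarrow> real"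
  assumes u: "u \<in> carrier_vec p" and mu: "\<mu> \<in> carrier_vec p" and n: "n \<ge> 1"
  defines "U \<equiv> \<lambda>k. u \<bullet> (vec p (x k) - \<mu>)"
  shows "u \<bullet> (sample_cov p n x *\<^sub>v u) = (\<Sum>k<n. (U k - (\<Sum>k<n. U k) / real n)\<^sup>2) / (real n - 1)"
proof -
  define c where "c k a = x k a - sample_mean n x a" for k a
  have lin: "U k = (\<Sum>a<p. u $ a * x k a) - (\<Sum>a<p. u $ a * \<mu> $ a)" for k
    by (simp add: U_def scalar_prod_centered[OF mu] right_diff_distrib sum_subtractf)
  have "(\<Sum>k<n. U k) / real n
      = (\<Sum>k<n. \<Sum>a<p. u $ a * x k a) / real n - (\<Sum>a<p. u $ a * \<mu> $ a)"
    using n by (simp add: lin sum_subtractf diff_divide_distrib)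
  also have "(\<Sum>k<n. \<Sum>a<p. u $ a * x k a) / real n = (\<Sum>a<p. u $ a * sample_mean n x a)"
    by (subst sum.swap) (simp add: sample_mean_def sum_distrib_left sum_divide_distrib)
  finally have U: "U k - (\<Sum>k<n. U k) / real n = (\<Sum>a<p. u $ a * c k a)" for k
    by (simp add: lin c_def right_diff_distrib sum_subtractf)
  have "u \<bullet> (sample_cov p n x *\<^sub>v u)
      = (\<Sum>a<p. \<Sum>b<p. \<Sum>k<n. u $ a * c k a * (u $ b * c k b) / (real n - 1))"
    using u by (simp add: scalar_prod_def sample_cov_def lessThan_atLeast0 sum_distrib_left
        sum_distrib_right sum_divide_distrib c_def mult_ac)
  also have "\<dots> = (\<Sum>a<p. \<Sum>k<n. \<Sum>b<p. u $ a * c k a * (u $ b * c k b) / (real n - 1))"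
    by (rule sum.cong[OF refl], rule sum.swap)
  also have "\<dots> = (\<Sum>k<n. \<Sum>a<p. \<Sum>b<p. u $ a * c k a * (u $ b * c k b) / (real n - 1))"
    by (rule sum.swap)
  also have "\<dots> = (\<Sum>k<n. (\<Sum>a<p. u $ a * c k a)\<^sup>2) / (real n - 1)"
    by (simp add: power2_eq_square sum_product sum_divide_distrib)
  finally show ?thesis unfolding U .
qed

context prob_space
begin

lemma sample_cov_index_measurable:
  assumes ind: "indep_vars (\<lambda>_. Pi\<^sub>M {..<p} (\<lambda>_. borel)) X {..<n}" and ab: "a < p" "b < p"
  shows "(\<lambda>\<omega>. sample_cov p n (\<lambda>k. X k \<omega>) $$ (a, b)) \<in> borel_measurable M"
proof -
  have "(\<lambda>\<omega>. X k \<omega> c) \<in> borel_measurable M" if "k < n" "c < p" for k c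
  proof -
    have "X k \<in> M \<rightarrow>\<^sub>M Pi\<^sub>M {..<p} (\<lambda>_. borel)"
      using ind that by (auto simp: indep_vars_def)
    from measurable_compose[OF this measurable_component_singleton[of c]] that show ?thesis by simp
  qed
  then show ?thesis using ab by (simp add: sample_cov_def sample_mean_def)
qed

context
  fixes X :: "nat \<Rightarrow> 'a \<Rightarrow> nat \<Rightarrow> real" and \<mu> :: "real vec" and \<Sigma> :: "real mat" and n p :: nat
  assumes mu: "\<mu> \<in> carrier_vec p" and S: "\<Sigma> \<in> carrier_mat p p" "pos_def_mat \<Sigma>"
    and X: "\<And>k. k < n \<Longrightarrow> mvn_distributed M (X k) \<mu> \<Sigma>"
    and ind: "indep_vars (\<lambda>_. Pi\<^sub>M {..<p} (\<lambda>_. borel)) X {..<n}" and n: "n \<ge> 2"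
begin

lemma sample_cov_quadratic_form_deviation:
  assumes u: "u \<in> carrier_vec p" and L: "u \<bullet> (\<Sigma> *\<^sub>v u) \<le> L" "L > 0"
  shows "integrable M (\<lambda>\<omega>. (u \<bullet> ((sample_cov p n (\<lambda>k. X k \<omega>) - \<Sigma>) *\<^sub>v u))\<^sup>2)"
    "expectation (\<lambda>\<omega>. (u \<bullet> ((sample_cov p n (\<lambda>k. X k \<omega>) - \<Sigma>) *\<^sub>v u))\<^sup>2) \<le> 580 * L\<^sup>2 / real n"
proof -
  define U where "U k \<omega> = u \<bullet> (vec p (X k \<omega>) - \<mu>)" for k \<omega>
  let ?v = "u \<bullet> (\<Sigma> *\<^sub>v u)"
  have "(\<lambda>x. u \<bullet> (vec p x - \<mu>)) \<in> borel_measurable (Pi\<^sub>M {..<p} (\<lambda>_. borel))"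
    unfolding scalar_prod_centered[OF mu] by simp
  then have indU: "indep_vars (\<lambda>_. borel) U {..<n}"
    unfolding U_def by (intro indep_vars_compose2[OF ind])
  have mgf: "gaussian_mgf M (U k) ?v" if "k < n" for k
    unfolding U_def by (rule mvn_linear_form_gaussian_mgf[OF mu S u X[OF that]])
  have v0: "0 \<le> ?v"
    using S u by (cases "u = 0\<^sub>v p") (auto simp: pos_def_mat_def less_imp_le)
  have n1: "n \<ge> 1" using n by simp
  have "u \<bullet> ((sample_cov p n x - \<Sigma>) *\<^sub>v u) = u \<bullet> (sample_cov p n x *\<^sub>v u) - ?v" for x
    using u S sample_cov_carrier[of p n x]
    by (simp add: minus_mult_distrib_mat_vec[of _ p p] scalar_prod_minus_distrib[of _ p])
  then have eq: "u \<bullet> ((sample_cov p n (\<lambda>k. X k \<omega>) - \<Sigma>) *\<^sub>v u)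
    = (\<Sum>k<n. (U k \<omega> - (\<Sum>k<n. U k \<omega>) / real n)\<^sup>2) / (real n - 1) - ?v" for \<omega>
    unfolding U_def sample_cov_quadratic_form[OF u mu n1, of "\<lambda>k. X k \<omega>", symmetric] by simp
  show "integrable M (\<lambda>\<omega>. (u \<bullet> ((sample_cov p n (\<lambda>k. X k \<omega>) - \<Sigma>) *\<^sub>v u))\<^sup>2)"
    "expectation (\<lambda>\<omega>. (u \<bullet> ((sample_cov p n (\<lambda>k. X k \<omega>) - \<Sigma>) *\<^sub>v u))\<^sup>2) \<le> 580 * L\<^sup>2 / real n"
    unfolding eq by (rule gaussian_sample_variance_deviation[OF indU n mgf v0 L]; assumption)+
qed

text \<open>Polarization, \<open>u\<^sup>T D v = ((u + v)\<^sup>T D (u + v) - (u - v)\<^sup>T D (u - v)) / 4\<close> for symmetric \<open>D\<close>. Both \<open>u + v\<close> and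
\<open>u - v\<close> have norm at most \<open>r\<close>, so the variances of their linear forms are at most \<open>c r\<^sup>2\<close>.\<close>

lemma sample_cov_bilinear_form_deviation:
  assumes u: "u \<in> carrier_vec p" and v: "v \<in> carrier_vec p"
    and c: "c > 0" "\<And>w. w \<in> carrier_vec p \<Longrightarrow> w \<bullet> (\<Sigma> *\<^sub>v w) \<le> c * (w \<bullet> w)"
    and r: "eucl_norm u + eucl_norm v \<le> r" "r > 0"
  shows "integrable M (\<lambda>\<omega>. (u \<bullet> ((sample_cov p n (\<lambda>k. X k \<omega>) - \<Sigma>) *\<^sub>v v))\<^sup>2)"
    "expectation (\<lambda>\<omega>. (u \<bullet> ((sample_cov p n (\<lambda>k. X k \<omega>) - \<Sigma>) *\<^sub>v v))\<^sup>2) \<le> 145 * (c * r\<^sup>2)\<^sup>2 / real n"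
proof -
  define D where "D \<omega> = sample_cov p n (\<lambda>k. X k \<omega>) - \<Sigma>" for \<omega>
  define Q where "Q w \<omega> = w \<bullet> (D \<omega> *\<^sub>v w)" for w \<omega>
  have D: "D \<omega> \<in> carrier_mat p p" for \<omega>
    unfolding D_def by (rule minus_carrier_mat[OF S(1)])
  have sD: "transpose_mat (D \<omega>) = D \<omega>" for \<omega>
  proof -
    have "transpose_mat (D \<omega>) = transpose_mat (sample_cov p n (\<lambda>k. X k \<omega>)) - transpose_mat \<Sigma>"
      unfolding D_def using S(1) sample_cov_carrier by (intro transpose_minus)
    then show ?thesis
      using S(2) by (simp add: sample_cov_symmetric pos_def_mat_def D_def)
  qed
  let ?L = "c * r\<^sup>2"
  have L: "?L > 0" using c r by simp
  have bound: "w \<bullet> (\<Sigma> *\<^sub>v w) \<le> ?L" if w: "w \<in> carrier_vec p" "eucl_norm w \<le> r" for w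
  proof -
    have "w \<bullet> w \<le> r\<^sup>2"
      unfolding eucl_norm_square[symmetric] using w(2) eucl_norm_nonneg by (intro power_mono)
    then have "c * (w \<bullet> w) \<le> ?L" using c(1) by simp
    then show ?thesis using c(2)[OF w(1)] by linarith
  qed
  (* -v, written so that u - v becomes a sum and quadratic_form_add applies to both terms *)
  define v' where "v' = (-1) \<cdot>\<^sub>v v"
  have v': "v' \<in> carrier_vec p" using v by (simp add: v'_def)
  have "eucl_norm (u + v) \<le> r" using eucl_norm_triangle[OF u v] r(1) by linarith
  then have vp: "(u + v) \<bullet> (\<Sigma> *\<^sub>v (u + v)) \<le> ?L" using u v by (intro bound) auto
  have "eucl_norm v' = eucl_norm v" by (simp add: v'_def eucl_norm_smult)
  then have "eucl_norm (u + v') \<le> r" using eucl_norm_triangle[OF u v'] r(1) by linarith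
  then have vm: "(u + v') \<bullet> (\<Sigma> *\<^sub>v (u + v')) \<le> ?L" using u v' by (intro bound) auto
  have upc: "u + v \<in> carrier_vec p" and umc: "u + v' \<in> carrier_vec p" using u v v' by auto
  note P = sample_cov_quadratic_form_deviation[OF upc vp L, folded D_def, folded Q_def]
  note N = sample_cov_quadratic_form_deviation[OF umc vm L, folded D_def, folded Q_def]
  have pol: "u \<bullet> (D \<omega> *\<^sub>v v) = (Q (u + v) \<omega> - Q (u + v') \<omega>) / 4" for \<omega>
  proof -
    have "u \<bullet> (D \<omega> *\<^sub>v v') = - (u \<bullet> (D \<omega> *\<^sub>v v))" "v' \<bullet> (D \<omega> *\<^sub>v v') = v \<bullet> (D \<omega> *\<^sub>v v)"
      using u v D[of \<omega>] by (simp_all add: v'_def mult_mat_vec[OF D v])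
    then show ?thesis
      unfolding Q_def quadratic_form_add[OF D sD u v] quadratic_form_add[OF D sD u v'] by simp
  qed
  let ?b = "\<lambda>\<omega>. ((Q (u + v) \<omega>)\<^sup>2 + (Q (u + v') \<omega>)\<^sup>2) / 8"
  have le: "(u \<bullet> (D \<omega> *\<^sub>v v))\<^sup>2 \<le> ?b \<omega>" for \<omega>
  proof -
    have "(Q (u + v) \<omega> - Q (u + v') \<omega>)\<^sup>2 \<le> 2 * ((Q (u + v) \<omega>)\<^sup>2 + (Q (u + v') \<omega>)\<^sup>2)"
      using zero_le_power2[of "Q (u + v) \<omega> + Q (u + v') \<omega>"] by (simp add: power2_sum power2_diff)
    then show ?thesis unfolding pol power_divide by simp
  qed
  have "(\<lambda>\<omega>. u \<bullet> (D \<omega> *\<^sub>v v)) \<in> borel_measurable M"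
  proof -
    have "u \<bullet> (D \<omega> *\<^sub>v v) = (\<Sum>a<p. u $ a * (\<Sum>b<p. D \<omega> $$ (a, b) * v $ b))" for \<omega>
      using D[of \<omega>] u v by (simp add: scalar_prod_def lessThan_atLeast0)
    moreover have "(\<lambda>\<omega>. D \<omega> $$ (a, b)) \<in> borel_measurable M" if "a < p" "b < p" for a b
      using that S(1) sample_cov_index_measurable[OF ind that] by (simp add: D_def)
    ultimately show ?thesis by simp
  qed
  then have m: "(\<lambda>\<omega>. (u \<bullet> (D \<omega> *\<^sub>v v))\<^sup>2) \<in> borel_measurable M" by simp
  have ib: "integrable M ?b" using P(1) N(1) by simp
  have i: "integrable M (\<lambda>\<omega>. (u \<bullet> (D \<omega> *\<^sub>v v))\<^sup>2)"
    by (rule Bochner_Integration.integrable_bound[OF ib m]) (use le in \<open>simp add: abs_of_nonneg\<close>)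
  then show "integrable M (\<lambda>\<omega>. (u \<bullet> ((sample_cov p n (\<lambda>k. X k \<omega>) - \<Sigma>) *\<^sub>v v))\<^sup>2)"
    unfolding D_def .
  have "expectation (\<lambda>\<omega>. (u \<bullet> (D \<omega> *\<^sub>v v))\<^sup>2) \<le> expectation ?b" by (intro integral_mono i ib le)
  also have "\<dots> = (expectation (\<lambda>\<omega>. (Q (u + v) \<omega>)\<^sup>2) + expectation (\<lambda>\<omega>. (Q (u + v') \<omega>)\<^sup>2)) / 8"
    using P(1) N(1) by simp
  also have "\<dots> \<le> 145 * ?L\<^sup>2 / real n" using P(2) N(2) by simp
  finally show "expectation (\<lambda>\<omega>. (u \<bullet> ((sample_cov p n (\<lambda>k. X k \<omega>) - \<Sigma>) *\<^sub>v v))\<^sup>2) \<le> 145 * ?L\<^sup>2 / real n"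
    unfolding D_def .
qed

end

end

section \<open>Restriction to a set of coordinates\<close>

text \<open>Here \<open>B\<close> is the zero-one matrix that selects the coordinates \<open>xs\<close>: \<open>B\<^sup>T\<close> restricts a vector to them,
\<open>B\<close> extends by 0, and \<open>S \<mapsto> B\<^sup>T S B\<close> restricts a matrix to the rows and columns in \<open>xs\<close>.\<close>

context
  fixes xs :: "nat list" and p :: nat and B :: "real mat"
  assumes lt: "set xs \<subseteq> {..<p}" and dist: "distinct xs"
    and B_def: "B = mat_of_cols p (map (unit_vec p) xs)"
begin

lemma unit_cols_carrier: "B \<in> carrier_mat p (length xs)"
  by (auto simp: B_def)

lemma unit_cols_nth_less: "a < length xs \<Longrightarrow> xs ! a < p"
  using lt nth_mem by fastforce

lemma unit_cols_col: "a < length xs \<Longrightarrow> col B a = unit_vec p (xs ! a)"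
  by (simp add: B_def col_mat_of_cols)

lemma unit_cols_transpose_mult_vec:
  assumes "x \<in> carrier_vec p" "a < length xs"
  shows "(transpose_mat B *\<^sub>v x) $ a = x $ (xs ! a)"
  using assms unit_cols_carrier unit_cols_col[OF assms(2)] unit_cols_nth_less[OF assms(2)]
  by simp

lemma unit_cols_conjugate_mult_vec:
  assumes S: "S \<in> carrier_mat p p" and v: "v \<in> carrier_vec (length xs)"
  shows "(transpose_mat B * S * B) *\<^sub>v v = transpose_mat B *\<^sub>v (S *\<^sub>v (B *\<^sub>v v))"
proof -
  have Bt: "transpose_mat B \<in> carrier_mat (length xs) p" using unit_cols_carrier by simp
  have Bv: "B *\<^sub>v v \<in> carrier_vec p" using unit_cols_carrier v by simp
  have "(transpose_mat B * S * B) *\<^sub>v v = (transpose_mat B * S) *\<^sub>v (B *\<^sub>v v)"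
    by (rule assoc_mult_mat_vec[OF mult_carrier_mat[OF Bt S] unit_cols_carrier v])
  also have "\<dots> = transpose_mat B *\<^sub>v (S *\<^sub>v (B *\<^sub>v v))"
    by (rule assoc_mult_mat_vec[OF Bt S Bv])
  finally show ?thesis .
qed

lemma unit_cols_conjugate_index:
  assumes S: "S \<in> carrier_mat p p" and a: "a < length xs" and b: "b < length xs"
  shows "(transpose_mat B * S * B) $$ (a, b) = S $$ (xs ! a, xs ! b)"
proof -
  let ?M = "transpose_mat B * S * B" and ?e = "unit_vec (length xs) b :: real vec"
  have M: "?M \<in> carrier_mat (length xs) (length xs)" using S unit_cols_carrier by auto
  have "B *\<^sub>v ?e = col B b"
    using unit_cols_carrier b by (intro eq_vecI) auto
  then have Be: "B *\<^sub>v ?e = unit_vec p (xs ! b)" using unit_cols_col[OF b] by simp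
  have "N $$ (a, b) = (N *\<^sub>v ?e) $ a" if "N \<in> carrier_mat (length xs) (length xs)" for N
    using that a b by simp
  then have "?M $$ (a, b) = (?M *\<^sub>v ?e) $ a" using M by blast
  also have "\<dots> = (S *\<^sub>v unit_vec p (xs ! b)) $ (xs ! a)"
    unfolding unit_cols_conjugate_mult_vec[OF S unit_vec_carrier] Be
    by (rule unit_cols_transpose_mult_vec[OF _ a]) (use S in simp)
  also have "\<dots> = S $$ (xs ! a, xs ! b)"
    using S unit_cols_nth_less[OF a] unit_cols_nth_less[OF b] by simp
  finally show ?thesis .
qed

lemma unit_cols_isometry:
  assumes "v \<in> carrier_vec (length xs)"
  shows "(B *\<^sub>v v) \<bullet> (B *\<^sub>v v) = v \<bullet> v"
proof -
  have "transpose_mat B * B = 1\<^sub>m (length xs)"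
  proof (rule eq_matI)
    fix a b assume "a < dim_row (1\<^sub>m (length xs) :: real mat)" "b < dim_col (1\<^sub>m (length xs) :: real mat)"
    then have ab: "a < length xs" "b < length xs" by auto
    then have "(transpose_mat B * B) $$ (a, b) = unit_vec p (xs ! a) \<bullet> unit_vec p (xs ! b)"
      using unit_cols_carrier unit_cols_col by simp
    also have "\<dots> = (if a = b then 1 else 0)"
      using ab unit_cols_nth_less dist by (simp add: nth_eq_iff_index_eq)
    finally show "(transpose_mat B * B) $$ (a, b) = 1\<^sub>m (length xs) $$ (a, b)" using ab by simp
  qed (use unit_cols_carrier in auto)
  then have "transpose_mat B *\<^sub>v (B *\<^sub>v v) = v"
    using unit_cols_carrier assms
    by (simp add: assoc_mult_mat_vec[of "transpose_mat B" "length xs" p B "length xs", symmetric])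
  moreover have "(transpose_mat B *\<^sub>v (B *\<^sub>v v)) \<bullet> v = (B *\<^sub>v v) \<bullet> (B *\<^sub>v v)"
    using unit_cols_carrier assms by (intro transpose_vec_mult_scalar[of _ p "length xs"]) auto
  ultimately show ?thesis by simp
qed

lemma unit_cols_conjugate_quadratic_form:
  assumes S: "S \<in> carrier_mat p p" and v: "v \<in> carrier_vec (length xs)"
  shows "v \<bullet> ((transpose_mat B * S * B) *\<^sub>v v) = (B *\<^sub>v v) \<bullet> (S *\<^sub>v (B *\<^sub>v v))"
proof -
  have x: "S *\<^sub>v (B *\<^sub>v v) \<in> carrier_vec p" using S v unit_cols_carrier by simp
  have "(transpose_mat B *\<^sub>v (S *\<^sub>v (B *\<^sub>v v))) \<bullet> v = (S *\<^sub>v (B *\<^sub>v v)) \<bullet> (B *\<^sub>v v)"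
    using unit_cols_carrier v x by (intro transpose_vec_mult_scalar[of _ p "length xs"]) auto
  then show ?thesis
    unfolding unit_cols_conjugate_mult_vec[OF S v] using x v unit_cols_carrier
      comm_scalar_prod[of v "length xs" "transpose_mat B *\<^sub>v (S *\<^sub>v (B *\<^sub>v v))"]
      comm_scalar_prod[of "B *\<^sub>v v" p "S *\<^sub>v (B *\<^sub>v v)"] by simp
qed

end

lemma nonzero_entries_carrier:
  assumes "A \<in> carrier_mat n n" "j < n"
  shows "nonzero_entries (col A j) \<in> carrier_vec (card (col_support A j))"
proof -
  have len: "length (list_of_vec (col A j)) = n" using assms by simp
  have nth: "list_of_vec (col A j) ! k = A $$ (k, j)" if "k < n" for k
    using that assms by (simp add: list_of_vec_index)
  have "{k. k < length (list_of_vec (col A j)) \<and> list_of_vec (col A j) ! k \<noteq> 0} = col_support A j"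
    unfolding len col_support_def using nth assms(1) by (intro Collect_cong) (metis carrier_matD(1))
  then have "length (filter (\<lambda>x. x \<noteq> 0) (list_of_vec (col A j))) = card (col_support A j)"
    by (simp only: length_filter_conv_card)
  then show ?thesis
    unfolding nonzero_entries_def by (intro carrier_vecI) (simp only: dim_vec_of_list)
qed

section \<open>Measurability of the inverse matrix\<close>

text \<open>The value 0 of \<open>inv_mat\<close> at singular matrices agrees with \<open>inverse 0 = 0\<close>, so Cramer's formula holds
without a case distinction. It expresses the entries of the inverse through determinants, that is,
polynomials in the entries of \<open>A\<close>, which gives measurability.\<close>

lemma inv_mat_eq_adj_mat:
  fixes A :: "real mat"
  assumes A: "A \<in> carrier_mat n n"
  shows "inv_mat A = inverse (det A) \<cdot>\<^sub>m adj_mat A"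
proof (cases "det A = 0")
  case True
  have "mat_inverse A = None"
  proof (cases "mat_inverse A")
    case (Some B)
    from mat_inverse(2)[OF A Some] have "A * B = 1\<^sub>m n" "B \<in> carrier_mat n n" by auto
    then have "det A * det B = 1" using det_mult[OF A] by (metis det_one)
    with True show ?thesis by simp
  qed
  then show ?thesis using True adj_mat(1)[OF A] A by (auto simp: inv_mat_def)
next
  case False
  have "inv_mat A * A = 1\<^sub>m n" and I: "inv_mat A \<in> carrier_mat n n"
    using False det_0_iff_vec_prod_zero[OF A] by (auto intro!: inv_mat_works[OF A])
  note adj = adj_mat[OF A]
  let ?R = "inverse (det A) \<cdot>\<^sub>m adj_mat A"
  have R: "?R \<in> carrier_mat n n" using adj by simp
  have AR: "A * ?R = 1\<^sub>m n"
    using adj A False by (subst mult_smult_distrib[of _ n n _ n]) (auto intro!: eq_matI)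
  have "inv_mat A = inv_mat A * (A * ?R)" using AR I by simp
  also have "\<dots> = (inv_mat A * A) * ?R" using I A R by (intro assoc_mult_mat[symmetric])
  also have "\<dots> = ?R" unfolding \<open>inv_mat A * A = 1\<^sub>m n\<close> by (rule left_mult_one_mat[OF R])
  finally show ?thesis .
qed

lemma borel_measurable_det:
  fixes F :: "'a \<Rightarrow> real mat"
  assumes F: "\<And>x. F x \<in> carrier_mat n n"
    and m: "\<And>a b. a < n \<Longrightarrow> b < n \<Longrightarrow> (\<lambda>x. F x $$ (a, b)) \<in> borel_measurable M"
  shows "(\<lambda>x. det (F x)) \<in> borel_measurable M"
  unfolding det_def'[OF F]
  by (intro borel_measurable_sum borel_measurable_times borel_measurable_prod m borel_measurable_const)
     (auto dest: permutes_in_image)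

lemma borel_measurable_inv_mat:
  fixes F :: "'a \<Rightarrow> real mat"
  assumes F: "\<And>x. F x \<in> carrier_mat n n"
    and m: "\<And>a b. a < n \<Longrightarrow> b < n \<Longrightarrow> (\<lambda>x. F x $$ (a, b)) \<in> borel_measurable M"
    and ab: "a < n" "b < n"
  shows "(\<lambda>x. inv_mat (F x) $$ (a, b)) \<in> borel_measurable M"
proof -
  have "(\<lambda>x. det (mat_delete (F x) b a)) \<in> borel_measurable M"
  proof (rule borel_measurable_det[where n = "n - 1"])
    show "mat_delete (F x) b a \<in> carrier_mat (n - 1) (n - 1)" for x by (rule mat_delete_carrier[OF F])
    fix a' b' assume "a' < n - 1" "b' < n - 1"
    moreover have "dim_row (F x) = n" "dim_col (F x) = n" for x using F[of x] by auto
    ultimately show "(\<lambda>x. mat_delete (F x) b a $$ (a', b')) \<in> borel_measurable M"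
      unfolding mat_delete_def by (auto intro!: m)
  qed
  then have "(\<lambda>x. inverse (det (F x)) * cofactor (F x) b a) \<in> borel_measurable M"
    unfolding cofactor_def by (intro borel_measurable_times borel_measurable_inverse
      borel_measurable_det[OF F m] borel_measurable_const)
  moreover have "inv_mat (F x) $$ (a, b) = inverse (det (F x)) * cofactor (F x) b a" for x
    using F[of x] ab adj_mat(1)[OF F[of x]] by (simp add: inv_mat_eq_adj_mat[OF F]) (simp add: adj_mat_def)
  ultimately show ?thesis by simp
qed

section \<open>Rate of convergence of the estimator\<close>

lemma covariance_mult_precision_col:
  assumes S: "\<Sigma> \<in> carrier_mat p p" and pd: "pos_def_mat \<Sigma>" and i: "i < p"
  shows "inv_mat \<Sigma> \<in> carrier_mat p p" "\<Sigma> *\<^sub>v col (inv_mat \<Sigma>) i = unit_vec p i"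
proof -
  note I = pos_def_mat_inverse[OF S pd]
  show "inv_mat \<Sigma> \<in> carrier_mat p p" by (rule I(1))
  have "\<Sigma> *\<^sub>v col (inv_mat \<Sigma>) i = col (\<Sigma> * inv_mat \<Sigma>) i"
    using S I(1) i by (intro eq_vecI) auto
  then show "\<Sigma> *\<^sub>v col (inv_mat \<Sigma>) i = unit_vec p i" using I(2) i by simp
qed

context prob_space
begin

text \<open>A bound for fixed \<open>n\<close>. The first term bounds the probability that the Frobenius distance between the
restricted matrices reaches \<open>C0 / 2\<close>, the second the probability that the image of \<open>w\<close> under their
difference is too large.\<close>

lemma precision_col_estimator_tail_bound:
  fixes X :: "nat \<Rightarrow> 'a \<Rightarrow> nat \<Rightarrow> real"
  assumes mu: "\<mu> \<in> carrier_vec p" and S: "\<Sigma> \<in> carrier_mat p p" "pos_def_mat \<Sigma>"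
    and X: "\<And>k. k < n \<Longrightarrow> mvn_distributed M (X k) \<mu> \<Sigma>"
    and ind: "indep_vars (\<lambda>_. Pi\<^sub>M {..<p} (\<lambda>_. borel)) X {..<n}" and n: "n \<ge> 2"
    and C0: "C0 > 0" and ev: "\<And>l. eigenvalue \<Sigma> l \<Longrightarrow> C0 \<le> l \<and> l \<le> inverse C0"
    and i: "i < p" and s: "card (col_support (inv_mat \<Sigma>) i) = s" "s \<ge> 1" and K: "K > 0"
  defines "err \<equiv> \<lambda>\<omega>. eucl_norm
     (precision_col_estimator (inv_mat \<Sigma>) i (sample_cov p n (\<lambda>k. X k \<omega>))
        - nonzero_entries (col (inv_mat \<Sigma>) i))"
  shows "err \<in> borel_measurable M"
    "prob {\<omega> \<in> space M. err \<omega> > K * sqrt (real s / real n)}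
      \<le> 580 * (4 / C0)\<^sup>2 / C0\<^sup>2 * ((real s)\<^sup>2 / real n)
        + 580 * ((1 + 1 / C0)\<^sup>2 / C0)\<^sup>2 / C0\<^sup>2 / K\<^sup>2"
proof -
  define \<Omega> where "\<Omega> = inv_mat \<Sigma>"
  have Om: "\<Omega> \<in> carrier_mat p p" and SO: "\<Sigma> *\<^sub>v col \<Omega> i = unit_vec p i"
    using covariance_mult_precision_col[OF S i] by (simp_all add: \<Omega>_def)
  have c: "col \<Omega> i \<in> carrier_vec p" using Om by (metis carrier_matD(1) col_dim)
  define xs where "xs = sorted_list_of_set (col_support \<Omega> i)"
  define B where "B = selection_mat \<Omega> i"
  have fin: "finite (col_support \<Omega> i)" by (simp add: col_support_def)
  have lt: "set xs \<subseteq> {..<p}" and dist: "distinct xs" and len: "length xs = s"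
    using fin Om s by (auto simp: xs_def col_support_def \<Omega>_def)
  have Bd: "B = mat_of_cols p (map (unit_vec p) xs)"
    using Om by (simp add: B_def selection_mat_def xs_def)
  note U = unit_cols_carrier[OF lt dist Bd, unfolded len] unit_cols_nth_less[OF lt dist Bd, unfolded len]
    unit_cols_transpose_mult_vec[OF lt dist Bd, unfolded len] unit_cols_conjugate_index[OF lt dist Bd, unfolded len]
    unit_cols_isometry[OF lt dist Bd, unfolded len] unit_cols_conjugate_mult_vec[OF lt dist Bd, unfolded len]
    unit_cols_conjugate_quadratic_form[OF lt dist Bd, unfolded len]
  note Bc = U(1)
  define w where "w = nonzero_entries (col \<Omega> i)"
  have w: "w \<in> carrier_vec s" using nonzero_entries_carrier[OF Om i] s by (simp add: w_def \<Omega>_def)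
  have Bw: "B *\<^sub>v w = col \<Omega> i"
    unfolding B_def w_def by (rule selection_mat_nonzero_entries) (use Om i in simp)
  have sS: "transpose_mat \<Sigma> = \<Sigma>" using S(2) by (simp add: pos_def_mat_def)
  have low: "C0 * (v \<bullet> v) \<le> v \<bullet> (\<Sigma> *\<^sub>v v)" if "v \<in> carrier_vec p" for v
    using ev that by (intro eigenvalue_lower_bound_quadratic_form[OF S(1) sS]) auto
  have up: "v \<bullet> (\<Sigma> *\<^sub>v v) \<le> 1 / C0 * (v \<bullet> v)" if "v \<in> carrier_vec p" for v
    using ev that by (intro eigenvalue_upper_bound_quadratic_form[OF S(1) sS]) (auto simp: inverse_eq_divide)
  define D where "D \<omega> = sample_cov p n (\<lambda>k. X k \<omega>) - \<Sigma>" for \<omega>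
  define A where "A = transpose_mat B * \<Sigma> * B"
  define T where "T \<omega> = transpose_mat B * sample_cov p n (\<lambda>k. X k \<omega>) * B" for \<omega>
  have Dc: "D \<omega> \<in> carrier_mat p p" for \<omega> unfolding D_def by (rule minus_carrier_mat[OF S(1)])
  have Ac: "A \<in> carrier_mat s s" using Bc S(1) by (auto simp: A_def)
  have Tc: "T \<omega> \<in> carrier_mat s s" for \<omega> using Bc sample_cov_carrier[of p n] by (auto simp: T_def)
  have unit: "unit_vec p a \<bullet> (D \<omega> *\<^sub>v v) = (D \<omega> *\<^sub>v v) $ a" if "a < p" "v \<in> carrier_vec p" for a \<omega> v
  proof -
    have "D \<omega> *\<^sub>v v \<in> carrier_vec p" by (rule mult_mat_vec_carrier[OF Dc that(2)])
    then show ?thesis by (rule scalar_prod_left_unit[OF _ that(1)])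
  qed
  (* Entries of T - A, and of its image of w, are bilinear forms of the deviation D, to which
     the moment bound applies. *)
  have TA: "(T \<omega> - A) $$ (a, b) = unit_vec p (xs ! a) \<bullet> (D \<omega> *\<^sub>v unit_vec p (xs ! b))"
    if "a < s" "b < s" for a b \<omega>
  proof -
    have "(T \<omega> - A) $$ (a, b) = T \<omega> $$ (a, b) - A $$ (a, b)" using that Ac by simp
    also have "\<dots> = D \<omega> $$ (xs ! a, xs ! b)"
      unfolding T_def A_def U(4)[OF sample_cov_carrier that] U(4)[OF S(1) that] D_def
      using U(2) that S(1) by simp
    also have "\<dots> = (D \<omega> *\<^sub>v unit_vec p (xs ! b)) $ (xs ! a)"
      using U(2)[OF that(1)] U(2)[OF that(2)] Dc[of \<omega>] by simp
    finally show ?thesis using unit[OF U(2)[OF that(1)], of "unit_vec p (xs ! b)"] by simp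
  qed
  have TAw: "((T \<omega> - A) *\<^sub>v w) $ a = unit_vec p (xs ! a) \<bullet> (D \<omega> *\<^sub>v col \<Omega> i)" if "a < s" for a \<omega>
  proof -
    have 1: "sample_cov p n (\<lambda>k. X k \<omega>) *\<^sub>v col \<Omega> i \<in> carrier_vec p"
      by (rule mult_mat_vec_carrier[OF sample_cov_carrier c])
    have 2: "\<Sigma> *\<^sub>v col \<Omega> i \<in> carrier_vec p" by (rule mult_mat_vec_carrier[OF S(1) c])
    have "((T \<omega> - A) *\<^sub>v w) $ a = (T \<omega> *\<^sub>v w) $ a - (A *\<^sub>v w) $ a"
      using that Ac by (subst minus_mult_distrib_mat_vec[OF Tc Ac w]) simp
    also have "\<dots> = (sample_cov p n (\<lambda>k. X k \<omega>) *\<^sub>v col \<Omega> i) $ (xs ! a) - (\<Sigma> *\<^sub>v col \<Omega> i) $ (xs ! a)"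
      unfolding T_def A_def U(6)[OF sample_cov_carrier w] U(6)[OF S(1) w] Bw U(3)[OF 1 that] U(3)[OF 2 that] ..
    also have "\<dots> = (D \<omega> *\<^sub>v col \<Omega> i) $ (xs ! a)"
      unfolding D_def minus_mult_distrib_mat_vec[OF sample_cov_carrier S(1) c]
      using S(1) U(2)[OF that] by simp
    finally show ?thesis using unit[OF U(2)[OF that] c] by simp
  qed
  define F where "F \<omega> = frobenius_norm_sq (T \<omega> - A)" for \<omega>
  define G where "G \<omega> = ((T \<omega> - A) *\<^sub>v w) \<bullet> ((T \<omega> - A) *\<^sub>v w)" for \<omega>
  have F: "F \<omega> = (\<Sum>a<s. \<Sum>b<s. (unit_vec p (xs ! a) \<bullet> (D \<omega> *\<^sub>v unit_vec p (xs ! b)))\<^sup>2)" for \<omega>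
    using Ac TA by (simp add: F_def frobenius_norm_sq_def)
  have G: "G \<omega> = (\<Sum>a<s. (unit_vec p (xs ! a) \<bullet> (D \<omega> *\<^sub>v col \<Omega> i))\<^sup>2)" for \<omega>
  proof -
    have d: "dim_vec ((T \<omega> - A) *\<^sub>v w) = s" using Ac by simp
    have "G \<omega> = (\<Sum>a<s. (((T \<omega> - A) *\<^sub>v w) $ a)\<^sup>2)"
      unfolding G_def scalar_prod_def d by (simp only: lessThan_atLeast0 power2_eq_square)
    then show ?thesis using TAw by simp
  qed
  have nu: "eucl_norm (unit_vec p a) = 1" if "a < p" for a
    using that by (simp add: eucl_norm_def)
  (* Test the equation for column i of the precision matrix against that column itself. *)
  have nw: "eucl_norm (col \<Omega> i) \<le> 1 / C0"
  proof -
    have "C0 * (eucl_norm (col \<Omega> i))\<^sup>2 \<le> col \<Omega> i \<bullet> unit_vec p i"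
      using low[OF c] unfolding SO eucl_norm_square .
    also have "\<dots> \<le> eucl_norm (col \<Omega> i) * 1"
      using scalar_prod_le_eucl_norm[OF c unit_vec_carrier, of i] nu[OF i] by simp
    finally have "eucl_norm (col \<Omega> i) * (C0 * eucl_norm (col \<Omega> i)) \<le> eucl_norm (col \<Omega> i) * 1"
      by (simp add: power2_eq_square mult_ac)
    then show ?thesis using C0 eucl_norm_nonneg[of "col \<Omega> i"]
      by (cases "eucl_norm (col \<Omega> i) = 0") (auto simp: mult_le_cancel_left field_simps)
  qed
  have C1: "1 / C0 > 0" using C0 by simp
  have dev: "integrable M (\<lambda>\<omega>. (u \<bullet> (D \<omega> *\<^sub>v v))\<^sup>2)"
    "expectation (\<lambda>\<omega>. (u \<bullet> (D \<omega> *\<^sub>v v))\<^sup>2) \<le> 145 * (1 / C0 * r\<^sup>2)\<^sup>2 / real n"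
    if "u \<in> carrier_vec p" "v \<in> carrier_vec p" "eucl_norm u + eucl_norm v \<le> r" "r > 0" for u v r
    unfolding D_def
    by (rule sample_cov_bilinear_form_deviation[OF mu S X ind n that(1,2) C1 up that(3,4)]; assumption)+
  (* The radii 2 and 1 + 1 / C0 bound the sums of the norms of the two vectors in the bilinear form. *)
  define c1 where "c1 = 145 * (1 / C0 * 2\<^sup>2)\<^sup>2"
  define c2 where "c2 = 145 * (1 / C0 * (1 + 1 / C0)\<^sup>2)\<^sup>2"
  have dF: "integrable M (\<lambda>\<omega>. (unit_vec p (xs ! a) \<bullet> (D \<omega> *\<^sub>v unit_vec p (xs ! b)))\<^sup>2)"
    "expectation (\<lambda>\<omega>. (unit_vec p (xs ! a) \<bullet> (D \<omega> *\<^sub>v unit_vec p (xs ! b)))\<^sup>2) \<le> c1 / real n"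
    if "a < s" "b < s" for a b
  proof -
    have "eucl_norm (unit_vec p (xs ! a)) + eucl_norm (unit_vec p (xs ! b)) \<le> 2"
      using nu U(2) that by simp
    note d = dev[OF unit_vec_carrier unit_vec_carrier this zero_less_numeral, folded c1_def]
    show "integrable M (\<lambda>\<omega>. (unit_vec p (xs ! a) \<bullet> (D \<omega> *\<^sub>v unit_vec p (xs ! b)))\<^sup>2)" by (rule d(1))
    show "expectation (\<lambda>\<omega>. (unit_vec p (xs ! a) \<bullet> (D \<omega> *\<^sub>v unit_vec p (xs ! b)))\<^sup>2) \<le> c1 / real n" by (rule d(2))
  qed
  have dG: "integrable M (\<lambda>\<omega>. (unit_vec p (xs ! a) \<bullet> (D \<omega> *\<^sub>v col \<Omega> i))\<^sup>2)"
    "expectation (\<lambda>\<omega>. (unit_vec p (xs ! a) \<bullet> (D \<omega> *\<^sub>v col \<Omega> i))\<^sup>2) \<le> c2 / real n"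
    if "a < s" for a
  proof -
    have le: "eucl_norm (unit_vec p (xs ! a)) + eucl_norm (col \<Omega> i) \<le> 1 + 1 / C0"
      using nu U(2) that nw by simp
    have pos: "0 < 1 + 1 / C0" using C1 by linarith
    note d = dev[OF unit_vec_carrier c le pos, folded c2_def]
    show "integrable M (\<lambda>\<omega>. (unit_vec p (xs ! a) \<bullet> (D \<omega> *\<^sub>v col \<Omega> i))\<^sup>2)" by (rule d(1))
    show "expectation (\<lambda>\<omega>. (unit_vec p (xs ! a) \<bullet> (D \<omega> *\<^sub>v col \<Omega> i))\<^sup>2) \<le> c2 / real n" by (rule d(2))
  qed
  have hF: "has_bochner_integral M F (\<Sum>a<s. \<Sum>b<s.
      expectation (\<lambda>\<omega>. (unit_vec p (xs ! a) \<bullet> (D \<omega> *\<^sub>v unit_vec p (xs ! b)))\<^sup>2))"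
    unfolding F by (intro has_bochner_integral_sum has_bochner_integral_integrable dF(1)) auto
  have hG: "has_bochner_integral M G (\<Sum>a<s.
      expectation (\<lambda>\<omega>. (unit_vec p (xs ! a) \<bullet> (D \<omega> *\<^sub>v col \<Omega> i))\<^sup>2))"
    unfolding G by (intro has_bochner_integral_sum has_bochner_integral_integrable dG(1)) auto
  note iF = integrable.intros[OF hF] and iG = integrable.intros[OF hG]
  have "expectation F \<le> (\<Sum>a<s. \<Sum>b<s. c1 / real n)"
    unfolding has_bochner_integral_integral_eq[OF hF] by (intro sum_mono dF(2)) auto
  then have eF: "expectation F \<le> (real s)\<^sup>2 * (c1 / real n)" by (simp add: power2_eq_square)
  have "expectation G \<le> (\<Sum>a<s. c2 / real n)"
    unfolding has_bochner_integral_integral_eq[OF hG] by (intro sum_mono dG(2)) auto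
  then have eG: "expectation G \<le> real s * (c2 / real n)" by simp
  have F0: "F \<omega> \<ge> 0" and G0: "G \<omega> \<ge> 0" for \<omega>
    unfolding F G by (auto intro!: sum_nonneg)
  (* This identifies the error with that of solving a perturbed linear system. *)
  have f: "transpose_mat B *\<^sub>v unit_vec p i = A *\<^sub>v w"
    unfolding A_def U(6)[OF S(1) w] Bw SO ..
  have err: "err \<omega> = eucl_norm (inv_mat (T \<omega>) *\<^sub>v (A *\<^sub>v w) - w)" for \<omega>
    using Om unfolding err_def \<Omega>_def[symmetric] precision_col_estimator_def Let_def B_def[symmetric]
      w_def[symmetric] T_def f[symmetric] by simp
  have lowA: "C0 * (v \<bullet> v) \<le> v \<bullet> (A *\<^sub>v v)" if v: "v \<in> carrier_vec s" for v
  proof -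
    have "B *\<^sub>v v \<in> carrier_vec p" using Bc v by simp
    from low[OF this] show ?thesis unfolding A_def U(7)[OF S(1) v] U(5)[OF v] .
  qed
  have pert: "err \<omega> \<le> 2 / C0 * sqrt (G \<omega>)" if "F \<omega> \<le> (C0 / 2)\<^sup>2" for \<omega>
    unfolding err G_def eucl_norm_def[symmetric]
    by (rule inv_mat_perturbation[OF Ac Tc C0 lowA _ w]) (use that in \<open>simp_all add: F_def\<close>)
  show m: "err \<in> borel_measurable M"
  proof -
    have TAm: "(\<lambda>\<omega>. T \<omega> $$ (a, b)) \<in> borel_measurable M" if "a < s" "b < s" for a b
    proof -
      have "T \<omega> $$ (a, b) = sample_cov p n (\<lambda>k. X k \<omega>) $$ (xs ! a, xs ! b)" for \<omega>
        unfolding T_def by (rule U(4)[OF sample_cov_carrier that])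
      then show ?thesis
        using sample_cov_index_measurable[OF ind U(2)[OF that(1)] U(2)[OF that(2)]] by (simp only:)
    qed
    have Tm: "(\<lambda>\<omega>. inv_mat (T \<omega>) $$ (a, b)) \<in> borel_measurable M" if "a < s" "b < s" for a b
      by (rule borel_measurable_inv_mat[OF Tc TAm that])
    have Ti: "inv_mat (T \<omega>) \<in> carrier_mat s s" for \<omega>
      unfolding inv_mat_eq_adj_mat[OF Tc] using adj_mat(1)[OF Tc] by simp
    have Aw: "A *\<^sub>v w \<in> carrier_vec s" by (rule mult_mat_vec_carrier[OF Ac w])
    have "err \<omega> = sqrt (\<Sum>a<s. ((\<Sum>b<s. inv_mat (T \<omega>) $$ (a, b) * (A *\<^sub>v w) $ b) - w $ a)\<^sup>2)" for \<omega>
    proof -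
      have d: "dim_vec (inv_mat (T \<omega>) *\<^sub>v (A *\<^sub>v w) - w) = s" using w by simp
      have "(inv_mat (T \<omega>) *\<^sub>v (A *\<^sub>v w) - w) $ a = (\<Sum>b<s. inv_mat (T \<omega>) $$ (a, b) * (A *\<^sub>v w) $ b) - w $ a"
        if "a < s" for a
      proof -
        have "(inv_mat (T \<omega>) *\<^sub>v x) $ a = (\<Sum>b<s. inv_mat (T \<omega>) $$ (a, b) * x $ b)"
          if "x \<in> carrier_vec s" for x
          using \<open>a < s\<close> that Ti[of \<omega>] by (simp add: scalar_prod_def lessThan_atLeast0)
        from this[OF Aw] show ?thesis using w \<open>a < s\<close> by simp
      qed
      then show ?thesis
        unfolding err eucl_norm_def scalar_prod_def d by (simp add: lessThan_atLeast0 power2_eq_square)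
    qed
    moreover have "(\<lambda>\<omega>. sqrt (\<Sum>a<s. ((\<Sum>b<s. inv_mat (T \<omega>) $$ (a, b) * (A *\<^sub>v w) $ b) - w $ a)\<^sup>2)) \<in> borel_measurable M"
      by (intro measurable_compose[OF _ borel_measurable_sqrt] borel_measurable_sum borel_measurable_power
          borel_measurable_diff borel_measurable_times Tm borel_measurable_const) auto
    ultimately show ?thesis by presburger
  qed
  (* On the event G < ?tG, the perturbation bound 2 / C0 * sqrt G is at most K * sqrt (s / n). *)
  let ?tF = "(C0 / 2)\<^sup>2" and ?tG = "(C0 * K / 2)\<^sup>2 * (real s / real n)"
  have tF: "?tF > 0" and tG: "?tG > 0" using C0 K s n by auto
  have sub: "{\<omega> \<in> space M. err \<omega> > K * sqrt (real s / real n)}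
      \<subseteq> {\<omega> \<in> space M. F \<omega> \<ge> ?tF} \<union> {\<omega> \<in> space M. G \<omega> \<ge> ?tG}"
  proof
    fix \<omega> assume \<omega>: "\<omega> \<in> {\<omega> \<in> space M. err \<omega> > K * sqrt (real s / real n)}"
    show "\<omega> \<in> {\<omega> \<in> space M. F \<omega> \<ge> ?tF} \<union> {\<omega> \<in> space M. G \<omega> \<ge> ?tG}"
    proof (rule ccontr)
      assume "\<omega> \<notin> {\<omega> \<in> space M. F \<omega> \<ge> ?tF} \<union> {\<omega> \<in> space M. G \<omega> \<ge> ?tG}"
      then have less: "F \<omega> \<le> ?tF" "G \<omega> \<le> ?tG" using \<omega> by auto
      have "sqrt (G \<omega>) \<le> sqrt ?tG" using less(2) by simp
      also have "\<dots> = C0 * K / 2 * sqrt (real s / real n)"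
        using C0 K unfolding real_sqrt_mult by simp
      finally have "2 / C0 * sqrt (G \<omega>) \<le> 2 / C0 * (C0 * K / 2 * sqrt (real s / real n))"
        using C0 by (intro mult_left_mono) auto
      then have "2 / C0 * sqrt (G \<omega>) \<le> K * sqrt (real s / real n)" using C0 by simp
      with pert[OF less(1)] \<omega> show False by simp
    qed
  qed
  have [measurable]: "F \<in> borel_measurable M" "G \<in> borel_measurable M" using iF iG by auto
  have mF: "{\<omega> \<in> space M. F \<omega> \<ge> ?tF} \<in> events" and mG: "{\<omega> \<in> space M. G \<omega> \<ge> ?tG} \<in> events"
    by measurable
  have "prob {\<omega> \<in> space M. err \<omega> > K * sqrt (real s / real n)}
      \<le> prob ({\<omega> \<in> space M. F \<omega> \<ge> ?tF} \<union> {\<omega> \<in> space M. G \<omega> \<ge> ?tG})"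
    using sub mF mG by (intro finite_measure_mono) auto
  also have "\<dots> \<le> prob {\<omega> \<in> space M. F \<omega> \<ge> ?tF} + prob {\<omega> \<in> space M. G \<omega> \<ge> ?tG}"
    by (rule measure_Un_le[OF mF mG])
  also have "\<dots> \<le> expectation F / ?tF + expectation G / ?tG"
    using F0 G0 tF tG by (intro add_mono integral_Markov_inequality_measure[where A = "{}"] iF iG) auto
  also have "\<dots> \<le> (real s)\<^sup>2 * (c1 / real n) / ?tF + real s * (c2 / real n) / ?tG"
    using eF eG tF tG by (intro add_mono divide_right_mono) auto
  also have "(real s)\<^sup>2 * (c1 / real n) / ?tF = 580 * (4 / C0)\<^sup>2 / C0\<^sup>2 * ((real s)\<^sup>2 / real n)"
    using C0 by (simp add: c1_def power_divide power_mult_distrib)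
  also have "real s * (c2 / real n) / ?tG = 580 * ((1 + 1 / C0)\<^sup>2 / C0)\<^sup>2 / C0\<^sup>2 / K\<^sup>2"
    using C0 s n K by (simp add: c2_def power_divide power_mult_distrib)
  finally show "prob {\<omega> \<in> space M. err \<omega> > K * sqrt (real s / real n)}
      \<le> 580 * (4 / C0)\<^sup>2 / C0\<^sup>2 * ((real s)\<^sup>2 / real n)
        + 580 * ((1 + 1 / C0)\<^sup>2 / C0)\<^sup>2 / C0\<^sup>2 / K\<^sup>2" .
qed

end

text \<open>Given \<open>\<epsilon>\<close>, the second term of the tail bound is made at most \<open>\<epsilon> / 2\<close> by the choice of \<open>K\<close>, and
the first is eventually at most \<open>\<epsilon> / 2\<close> because \<open>s0 n ^ 2 / n\<close> tends to 0.\<close>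

theorem theorem1:
  fixes M :: "nat \<Rightarrow> 'a measure"
    and X :: "nat \<Rightarrow> nat \<Rightarrow> 'a \<Rightarrow> nat \<Rightarrow> real"
    and p s0 i :: "nat \<Rightarrow> nat"
    and \<mu> :: "nat \<Rightarrow> real vec"
    and \<Sigma> \<Omega> :: "nat \<Rightarrow> real mat"
    and C0 :: real
  assumes "\<And>n. n \<ge> 1 \<Longrightarrow> prob_space (M n)"
    and "\<And>n. n \<ge> 1 \<Longrightarrow> \<mu> n \<in> carrier_vec (p n)"
    and "\<And>n. n \<ge> 1 \<Longrightarrow> \<Sigma> n \<in> carrier_mat (p n) (p n)"
    and "\<And>n. n \<ge> 1 \<Longrightarrow> pos_def_mat (\<Sigma> n)"
    and "\<And>n. n \<ge> 1 \<Longrightarrow> \<Omega> n = inv_mat (\<Sigma> n)"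
    and "\<And>n k. n \<ge> 1 \<Longrightarrow> k < n \<Longrightarrow> mvn_distributed (M n) (X n k) (\<mu> n) (\<Sigma> n)"
    and "\<And>n. n \<ge> 1 \<Longrightarrow>
           prob_space.indep_vars (M n) (\<lambda>_. Pi\<^sub>M {..<p n} (\<lambda>_. borel)) (X n) {..<n}"
    and "\<And>n. n \<ge> 1 \<Longrightarrow> s0 n \<ge> 1"
    and "\<And>n j. n \<ge> 1 \<Longrightarrow> j < p n \<Longrightarrow> card (col_support (\<Omega> n) j) = s0 n"
    and "(\<lambda>n. real (s0 n)) \<in> o(\<lambda>n. sqrt (real n))"
    and "C0 > 0"
    and "\<And>n l. n \<ge> 1 \<Longrightarrow> eigenvalue (\<Sigma> n) l \<Longrightarrow> C0 \<le> l \<and> l \<le> inverse C0"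
    and "\<And>n. n \<ge> 1 \<Longrightarrow> i n < p n"
  shows "bigOP M
     (\<lambda>n \<omega>. eucl_norm
        (precision_col_estimator (\<Omega> n) (i n) (sample_cov (p n) n (\<lambda>k. X n k \<omega>))
          - nonzero_entries (col (\<Omega> n) (i n))))
     (\<lambda>n \<omega>. sqrt (real (s0 n) / real n))"
proof -
  let ?err = "\<lambda>n \<omega>. eucl_norm
        (precision_col_estimator (\<Omega> n) (i n) (sample_cov (p n) n (\<lambda>k. X n k \<omega>))
          - nonzero_entries (col (\<Omega> n) (i n)))"
  define c1 where "c1 = 580 * (4 / C0)\<^sup>2 / C0\<^sup>2"
  define c2 where "c2 = 580 * ((1 + 1 / C0)\<^sup>2 / C0)\<^sup>2 / C0\<^sup>2"
  have c: "c1 > 0" "c2 \<ge> 0" using assms(11) by (auto simp: c1_def c2_def)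
  have tail: "?err n \<in> borel_measurable (M n)"
    "measure (M n) {\<omega> \<in> space (M n). ?err n \<omega> > K * sqrt (real (s0 n) / real n)}
      \<le> c1 * ((real (s0 n))\<^sup>2 / real n) + c2 / K\<^sup>2" if n: "n \<ge> 2" and K: "K > 0" for n K
  proof -
    have n1: "n \<ge> 1" using n by simp
    interpret prob_space "M n" by (rule assms(1)[OF n1])
    have card: "card (col_support (inv_mat (\<Sigma> n)) (i n)) = s0 n"
      using assms(9)[OF n1 assms(13)[OF n1]] unfolding assms(5)[OF n1] .
    note t = precision_col_estimator_tail_bound[OF assms(2)[OF n1] assms(3)[OF n1] assms(4)[OF n1]
      assms(6)[OF n1] assms(7)[OF n1] n assms(11) assms(12)[OF n1] assms(13)[OF n1] card assms(8)[OF n1] K]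
    show "?err n \<in> borel_measurable (M n)" unfolding assms(5)[OF n1] by (rule t(1))
    show "measure (M n) {\<omega> \<in> space (M n). ?err n \<omega> > K * sqrt (real (s0 n) / real n)}
      \<le> c1 * ((real (s0 n))\<^sup>2 / real n) + c2 / K\<^sup>2"
      unfolding assms(5)[OF n1] c1_def c2_def by (rule t(2))
  qed
  show ?thesis
    unfolding bigOP_def bounded_in_prob_def
  proof (intro allI impI)
    fix \<epsilon> :: real assume eps: "\<epsilon> > 0"
    (* c2 + 1 instead of c2 makes K positive in every case. *)
    define K where "K = sqrt (2 * (c2 + 1) / \<epsilon>)"
    have K: "K > 0" "c2 / K\<^sup>2 \<le> \<epsilon> / 2"
      using eps c by (auto simp: K_def field_simps)
    define \<delta> where "\<delta> = sqrt (\<epsilon> / (2 * c1))"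
    have delta: "\<delta> > 0" "\<delta>\<^sup>2 = \<epsilon> / (2 * c1)" using eps c by (auto simp: \<delta>_def)
    have small: "\<forall>\<^sub>F n in sequentially. norm (real (s0 n)) \<le> \<delta> * norm (sqrt (real n))"
      by (rule landau_o.smallD[OF assms(10) delta(1)])
    from eventually_ge_at_top[of 2] small have "\<forall>\<^sub>F n in sequentially.
        {\<omega> \<in> space (M n). \<bar>?err n \<omega> / sqrt (real (s0 n) / real n)\<bar> > K} \<in> sets (M n) \<and>
        measure (M n) {\<omega> \<in> space (M n). \<bar>?err n \<omega> / sqrt (real (s0 n) / real n)\<bar> > K} \<le> \<epsilon>"
    proof eventually_elim
      case (elim n)
      have pos: "sqrt (real (s0 n) / real n) > 0" using assms(8)[of n] elim(1) by simp
      have eq: "{\<omega> \<in> space (M n). \<bar>?err n \<omega> / sqrt (real (s0 n) / real n)\<bar> > K}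
        = {\<omega> \<in> space (M n). ?err n \<omega> > K * sqrt (real (s0 n) / real n)}"
        using pos eucl_norm_nonneg by (intro Collect_cong) (simp only: abs_divide abs_of_nonneg abs_of_pos pos_less_divide_eq)
      have "(real (s0 n))\<^sup>2 \<le> (\<delta> * sqrt (real n))\<^sup>2" using elim(2) by (intro power_mono) auto
      then have "(real (s0 n))\<^sup>2 / real n \<le> \<delta>\<^sup>2" using elim(1) by (simp add: power_mult_distrib field_simps)
      then have "c1 * ((real (s0 n))\<^sup>2 / real n) \<le> c1 * \<delta>\<^sup>2" using c by (intro mult_left_mono) auto
      also have "\<dots> = \<epsilon> / 2" using c by (simp add: delta(2))
      finally have "c1 * ((real (s0 n))\<^sup>2 / real n) + c2 / K\<^sup>2 \<le> \<epsilon>" using K(2) by linarith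
      with tail(2)[OF elim(1) K(1)] have "measure (M n)
          {\<omega> \<in> space (M n). ?err n \<omega> > K * sqrt (real (s0 n) / real n)} \<le> \<epsilon>" by linarith
      moreover have "{\<omega> \<in> space (M n). ?err n \<omega> > K * sqrt (real (s0 n) / real n)} \<in> sets (M n)"
        using tail(1)[OF elim(1) K(1)] by measurable
      ultimately show ?case unfolding eq by blast
    qed
    then show "\<exists>K. \<forall>\<^sub>F n in sequentially.
        {\<omega> \<in> space (M n). \<bar>?err n \<omega> / sqrt (real (s0 n) / real n)\<bar> > K} \<in> sets (M n) \<and>
        measure (M n) {\<omega> \<in> space (M n). \<bar>?err n \<omega> / sqrt (real (s0 n) / real n)\<bar> > K} \<le> \<epsilon>"
      by (rule exI[of _ K])
  qed
qed

end
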